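(* Let $(n_k)_{k\ge1}$ be a sequence of positive integers satisfying the Hadamard gap condition: there is $q>1$ with $n_{k+1}/n_k\ge q$ for all $k\ge1$. Let $\sigma:\mathbb N\to\mathbb N$ be any permutation of the positive integers. Then, on the probability space $([0,1],\mathcal B,\lambda)$ ($\lambda$ = Lebesgue measure), $$N^{-1/2}\sum_{k=1}^N \cos 2\pi n_{\sigma(k)}x \xrightarrow{\ \mathcal D\ } \mathcal N(0,1/2)\qquad (N\to\infty),$$ and $$\limsup_{N\to\infty}\frac{\sum_{k=1}^N\cos 2\pi n_{\sigma(k)}x}{\sqrt{N\log\log N}}=1\quad\text{for }\lambda\text{-almost every }x\in[0,1].$$
   Context: $\xrightarrow{\mathcal D}$ denotes convergence in distribution of functions of $x$ viewed as random variables on $([0,1],\mathcal B,\lambda)$; $\mathcal N(0,1/2)$ is the centered normal law with variance $1/2$. *)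

theory Defs
  imports "HOL-Probability.Probability"
begin

definition unit_interval_space :: "real measure" where
  "unit_interval_space = restrict_space lborel {0..1}"

(* N(mu, v) given by variance v (normal_density takes the standard deviation) *)
definition normal_distribution_var :: "real \<Rightarrow> real \<Rightarrow> real measure" where
  "normal_distribution_var \<mu> v = density lborel (normal_density \<mu> (sqrt v))"

end

theory Submission
  imports Defs "HOL-Real_Asymp.Real_Asymp"
begin

text \<open>Every estimate concerns \<open>S\<^sub>A = (\<Sum>k\<in>A. cos (2 * pi * n k * x))\<close> for an arbitrary finite set \<open>A\<close> of
  indices, so the permutation only enters through \<open>A\<close>. Cut the index line into blocks of constant
  length \<open>L\<close> separated by gaps of constant length \<open>g\<close>. With \<open>T\<close> denoting the (weighted) block sums,
  the factors \<open>1 + z T + z\<^sup>2 T\<^sup>2 / 2\<close> are, up to their means, trigonometric polynomials whose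
  frequencies dominate those of all earlier factors; hence the integral of their product is exactly
  the product of the means. Comparing \<open>exp T\<close> and \<open>cis T\<close> with these factors gives two-sided
  Gaussian bounds for exponential moments and a bound for characteristic functions, with an error
  cubic in the weights. The indices lost in the gaps are a proportion \<open>g / (L + g)\<close> for a
  suitable shift of the blocks, or are removed by averaging over all shifts.

  The characteristic functions give the central limit theorem. For the iterated logarithm,
  the moment bounds and dyadic chaining give the upper half; for the lower half, the densities
  \<open>exp (u S\<^sub>B - u\<^sup>2 card B / 4)\<close> attached to the geometric blocks of summation indices
  concentrate on the desired events and are asymptotically uncorrelated, so that a second moment
  argument shows that infinitely many of these events occur.\<close>

section \<open>Trigonometric polynomials on the unit interval\<close>

text \<open>The difficulty is a ratio \<open>q\<close> close to 1. A Riesz-type product with one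
  cosine per factor needs large ratios; dropping \<open>g\<close> indices between blocks, with
  \<open>q ^ g\<close> at least \<open>K\<close>, restores them between blocks. Inside a block only
  the Hadamard condition is left, and stopping at the quadratic term makes it enough: the
  frequencies that occur are \<open>n a\<close>, \<open>2 * n a\<close> and
  \<open>n a \<plusminus> n b\<close>, and a difference of two terms cannot be small, whereas a
  cubic term would bring in \<open>n a + n b - n c\<close>, which can vanish for small
  \<open>q\<close>.

  Each cosine has variance 1/2, and Gaussian exponents are half the variance: hence
  \<open>u\<^sup>2 * card A / 4\<close> throughout, the limit law with variance 1/2, and the
  constant 1 in the iterated logarithm.

  Averaging over shifts relies on convexity and so gives upper bounds only. The lower half fixes one
  shift for each geometric block of summation indices, and two such blocks decouple only if their
  shifts agree. Since there are only \<open>L + g\<close> shifts, one of them is used by block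
  numbers that still carry a divergent series.\<close>

lemma prob_space_unit_interval: "prob_space unit_interval_space"
  unfolding unit_interval_space_def
  by (rule prob_space_restrict_space) auto

lemma space_unit_interval [simp]: "space unit_interval_space = {0..1}"
  by (simp add: unit_interval_space_def space_restrict_space)

interpretation U: prob_space unit_interval_space
  by (rule prob_space_unit_interval)

lemma unit_interval_measurable:
  fixes f :: "real \<Rightarrow> 'b::topological_space"
  assumes "f \<in> borel_measurable borel"
  shows "f \<in> borel_measurable unit_interval_space"
  using assms by (simp add: unit_interval_space_def measurable_restrict_space1)

lemma unit_interval_integrable:
  fixes f :: "real \<Rightarrow> 'b::{banach, second_countable_topology}"
  assumes "continuous_on UNIV f"
  shows "integrable unit_interval_space f"
proof -
  have "integrable lborel (\<lambda>x. indicator {0..1} x *\<^sub>R f x)"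
    using borel_integrable_compact[of "{0..1::real}" f] continuous_on_subset[OF assms]
    by auto
  then show ?thesis
    unfolding unit_interval_space_def by (subst integrable_restrict_space) auto
qed

text \<open>\<open>F\<close> is any set containing the frequencies, possibly infinite. Coefficients
  and repetitions are not recorded, because the integral vanishes as soon as
  \<open>0 \<notin> F\<close>.\<close>

inductive trig_poly :: "int set \<Rightarrow> (real \<Rightarrow> complex) \<Rightarrow> bool" for F where
  zero: "trig_poly F (\<lambda>x. 0)"
| add: "m \<in> F \<Longrightarrow> trig_poly F f \<Longrightarrow> trig_poly F (\<lambda>x. c * cis (2 * pi * of_int m * x) + f x)"

lemma trig_poly_cong: "trig_poly F f \<Longrightarrow> (\<And>x. f x = g x) \<Longrightarrow> trig_poly F g"
  by (simp add: ext[of f g])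

lemma trig_poly_monom: "m \<in> F \<Longrightarrow> trig_poly F (\<lambda>x. c * cis (2 * pi * of_int m * x))"
  using trig_poly.add[OF _ trig_poly.zero] by simp

lemma trig_poly_const: "0 \<in> F \<Longrightarrow> trig_poly F (\<lambda>x. c)"
  using trig_poly_monom[of 0 F c] by simp

lemma trig_poly_plus:
  assumes "trig_poly F f" "trig_poly F g"
  shows "trig_poly F (\<lambda>x. f x + g x)"
  using assms
proof (induction rule: trig_poly.induct)
  case (add m f c)
  then show ?case using trig_poly.add[OF add(1), of "\<lambda>x. f x + g x" c]
    by (auto simp: add.assoc)
qed simp

lemma trig_poly_scale:
  assumes "trig_poly F f" shows "trig_poly F (\<lambda>x. c * f x)"
  using assms
proof (induction rule: trig_poly.induct)
  case (add m f d)
  then show ?case using trig_poly.add[OF add(1), of "\<lambda>x. c * f x" "c * d"]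
    by (auto simp: algebra_simps)
qed (simp add: trig_poly.zero)

lemma trig_poly_mono:
  assumes "trig_poly F f" "F \<subseteq> G" shows "trig_poly G f"
  using assms by (induction rule: trig_poly.induct) (auto intro: trig_poly.intros)

lemma trig_poly_sum:
  assumes "\<And>i. i \<in> I \<Longrightarrow> trig_poly F (f i)"
  shows "trig_poly F (\<lambda>x. \<Sum>i\<in>I. f i x)"
  using assms
  by (induction I rule: infinite_finite_induct) (auto intro: trig_poly_plus trig_poly.zero)

lemma trig_poly_mult:
  assumes "trig_poly F f" "trig_poly G g" "\<And>a b. a \<in> F \<Longrightarrow> b \<in> G \<Longrightarrow> a + b \<in> H"
  shows "trig_poly H (\<lambda>x. f x * g x)"
  using assms(1)
proof (induction rule: trig_poly.induct)
  case zero
  then show ?case by (simp add: trig_poly.zero)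
next
  case (add a f c)
  have "trig_poly H (\<lambda>x. c * cis (2 * pi * of_int a * x) * g x)"
    using assms(2)
  proof (induction rule: trig_poly.induct)
    case zero
    then show ?case by (simp add: trig_poly.zero)
  next
    case (add b g d)
    have "trig_poly H (\<lambda>x. (c * d) * cis (2 * pi * of_int (a + b) * x) + c * cis (2 * pi * of_int a * x) * g x)"
      using trig_poly.add[OF assms(3)[OF \<open>a \<in> F\<close> \<open>b \<in> G\<close>] add.IH] .
    then show ?case
      by (rule trig_poly_cong) (simp add: algebra_simps flip: cis_mult)
  qed
  from trig_poly_plus[OF this add.IH] show ?case
    by (rule trig_poly_cong) (simp add: algebra_simps)
qed

lemma trig_poly_continuous: "trig_poly F f \<Longrightarrow> continuous_on UNIV f"
  by (induction rule: trig_poly.induct) (auto intro!: continuous_intros)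

lemma integral_cis_unit_interval:
  assumes "m \<noteq> 0"
  shows "(LINT x|unit_interval_space. cis (2 * pi * of_int m * x)) = 0"
proof -
  let ?k = "2 * pi * of_int m :: real"
  let ?F = "\<lambda>x::real. cis (?k * x) / (\<i> * ?k)"
  have k: "?k \<noteq> 0" using assms by simp
  have "(LBINT x. indicator {0..1} x *\<^sub>R cis (?k * x)) = ?F 1 - ?F 0"
  proof (rule integral_FTC_Icc[of 0 1 ?F "\<lambda>x. cis (?k * x)"])
    fix x :: real
    let ?G = "\<lambda>z. exp (\<i> * ?k * z) / (\<i> * ?k)"
    have "(?G has_field_derivative exp (\<i> * ?k * of_real x)) (at (of_real x))"
      by (rule derivative_eq_intros refl | use k in simp)+
    from has_vector_derivative_real_field[OF this]
    show "(?F has_vector_derivative cis (?k * x)) (at x within {0..1})"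
      by (simp add: cis_conv_exp mult_ac)
  qed (auto intro!: continuous_intros)
  also have "\<dots> = 0" using cis_multiple_2pi[of "of_int m"] by (simp add: mult.commute)
  finally show ?thesis unfolding unit_interval_space_def by (subst integral_restrict_space) auto
qed

lemma trig_poly_integral_zero:
  assumes "trig_poly F f" "0 \<notin> F"
  shows "(LINT x|unit_interval_space. f x) = 0"
  using assms
proof (induction rule: trig_poly.induct)
  case (add m f c)
  have 1: "integrable unit_interval_space (\<lambda>x. c * cis (2 * pi * of_int m * x))"
    by (intro unit_interval_integrable continuous_intros)
  have 2: "integrable unit_interval_space f"
    using add.hyps trig_poly_continuous unit_interval_integrable by blast
  have "m \<noteq> 0" using add by auto
  then show ?case using add 1 2 integral_cis_unit_interval[of m]
    by (simp add: Bochner_Integration.integral_add)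
qed simp

text \<open>The frequencies of the factor \<open>h j\<close> dominate all those of the preceding partial product, so
  in the expanded product only the constant terms survive integration.\<close>
lemma trig_poly_prod_integral:
  fixes \<alpha> :: "nat \<Rightarrow> complex"
  assumes h: "\<And>j. j < J \<Longrightarrow> trig_poly (H j) (h j)"
    and F0: "0 \<in> F 0"
    and F: "\<And>j. j < J \<Longrightarrow> F j \<subseteq> F (Suc j)"
    and FH: "\<And>j a b. j < J \<Longrightarrow> a \<in> F j \<Longrightarrow> b \<in> H j \<Longrightarrow> a + b \<in> F (Suc j) - {0}"
  shows "trig_poly (F J) (\<lambda>x. \<Prod>j<J. \<alpha> j + h j x) \<and>
    (LINT x|unit_interval_space. (\<Prod>j<J. \<alpha> j + h j x)) = (\<Prod>j<J. \<alpha> j)"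
  using h F FH
proof (induction J)
  case 0
  then show ?case using trig_poly_const[OF F0, of 1] U.prob_space by simp
next
  case (Suc J)
  let ?P = "\<lambda>x. \<Prod>j<J. \<alpha> j + h j x"
  have IH: "trig_poly (F J) ?P" "(LINT x|unit_interval_space. ?P x) = (\<Prod>j<J. \<alpha> j)"
    using Suc.IH[OF Suc.prems] by simp_all
  have ph: "trig_poly (F (Suc J) - {0}) (\<lambda>x. ?P x * h J x)"
    by (rule trig_poly_mult[OF IH(1) Suc.prems(1)[of J]]) (use Suc.prems(3)[of J] in auto)
  have pa: "trig_poly (F (Suc J)) (\<lambda>x. \<alpha> J * ?P x)"
    using trig_poly_mono[OF IH(1) Suc.prems(2)[of J]] by (intro trig_poly_scale) auto
  have eq: "(\<Prod>j<Suc J. \<alpha> j + h j x) = \<alpha> J * ?P x + ?P x * h J x" for x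
    by (simp add: algebra_simps)
  have "(LINT x|unit_interval_space. \<alpha> J * ?P x + ?P x * h J x) =
     (LINT x|unit_interval_space. \<alpha> J * ?P x) + (LINT x|unit_interval_space. ?P x * h J x)"
    by (intro Bochner_Integration.integral_add unit_interval_integrable
        trig_poly_continuous[OF pa] trig_poly_continuous[OF ph])
  also have "\<dots> = \<alpha> J * (\<Prod>j<J. \<alpha> j)"
    using trig_poly_integral_zero[OF ph] IH by simp
  finally show ?case
    unfolding eq using trig_poly_plus[OF pa trig_poly_mono[OF ph]] by (auto simp: mult.commute)
qed

section \<open>Lacunary sums over separated blocks\<close>

lemma trig_poly_cos:
  assumes "m \<in> F" "- m \<in> F"
  shows "trig_poly F (\<lambda>x. c * complex_of_real (cos (2 * pi * of_int m * x)))"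
proof -
  have "trig_poly F (\<lambda>x. c / 2 * cis (2 * pi * of_int m * x) + c / 2 * cis (2 * pi * of_int (- m) * x))"
    by (intro trig_poly_plus trig_poly_monom assms)
  then show ?thesis
    by (rule trig_poly_cong) (auto simp: complex_eq_iff field_simps)
qed

locale lacunary =
  fixes n :: "nat \<Rightarrow> nat" and q :: real
  assumes pos: "\<And>k. k \<ge> 1 \<Longrightarrow> n k > 0"
    and q: "q > 1"
    and gap: "\<And>k. k \<ge> 1 \<Longrightarrow> real (n (Suc k)) / real (n k) \<ge> q"
begin

text \<open>Frequencies of a block are at least \<open>2 * \<rho>\<close> times its elements (lemma \<open>diff_ge\<close>); the ratio \<open>K\<close>
  between blocks keeps the accumulated frequencies of earlier blocks below \<open>\<rho>\<close> times those elements,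
  since \<open>\<rho> + 2 = \<rho> * K\<close>.\<close>
definition \<rho> :: real where "\<rho> = (1 - 1 / q) / 2"

definition K :: real where "K = (\<rho> + 2) / \<rho>"

lemma rho_pos: "\<rho> > 0"
  using q by (simp add: \<rho>_def field_simps)

lemma growth:
  assumes "1 \<le> a" shows "q ^ d * n a \<le> n (a + d)"
proof (induction d)
  case (Suc d)
  have "q * real (n (a + d)) \<le> n (Suc (a + d))"
    using gap[of "a + d"] pos[of "a + d"] assms by (simp add: field_simps)
  moreover have "q * (q ^ d * n a) \<le> q * n (a + d)"
    using Suc q by (intro mult_left_mono) auto
  ultimately show ?case by simp
qed simp

lemma growth_less:
  assumes "1 \<le> a" "a < b" shows "q * n a \<le> n b"
proof -
  have "q ^ 1 * n a \<le> q ^ (b - a) * n a"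
    using q assms by (intro mult_right_mono power_increasing) auto
  also have "\<dots> \<le> n b" using growth[of a "b - a"] assms by simp
  finally show ?thesis by simp
qed

lemma diff_ge:
  assumes "1 \<le> a" "a < b"
  shows "2 * \<rho> * n b \<le> real (n b) - n a"
  using growth_less[OF assms] q by (simp add: \<rho>_def field_simps)

definition block_sum :: "(nat \<Rightarrow> real) \<Rightarrow> nat set \<Rightarrow> real \<Rightarrow> real" where
  "block_sum c B x = (\<Sum>k\<in>B. c k * cos (2 * pi * real (n k) * x))"

text \<open>Holds the frequencies \<open>n a\<close> of a block sum as well as the nonconstant
  frequencies \<open>2 * n a\<close> and \<open>n a \<plusminus> n b\<close> of its square. The
  lower bound prevents cancellation against earlier blocks, the upper bound controls what is passed
  on to later ones.\<close>

definition block_freqs :: "nat set \<Rightarrow> int set" where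
  "block_freqs B = {m. (\<exists>a\<in>B. 2 * \<rho> * n a \<le> \<bar>m\<bar>) \<and> (\<exists>b\<in>B. \<bar>m\<bar> \<le> 2 * real (n b))}"

lemma two_rho_le_1: "2 * \<rho> \<le> 1"
  using q by (simp add: \<rho>_def)

lemma block_freqsI:
  assumes "a \<in> B" "b \<in> B" "2 * \<rho> * n a \<le> \<bar>m\<bar>" "\<bar>m\<bar> \<le> 2 * real (n b)"
  shows "m \<in> block_freqs B" "- m \<in> block_freqs B"
  using assms by (auto simp: block_freqs_def)

lemma trig_poly_block_sum:
  assumes "B \<subseteq> {1..}"
  shows "trig_poly (block_freqs B) (\<lambda>x. of_real (block_sum c B x))"
proof -
  have "trig_poly (block_freqs B) (\<lambda>x. of_real (c k) * of_real (cos (2 * pi * of_int (int (n k)) * x)))"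
    if "k \<in> B" for k
    by (intro trig_poly_cos block_freqsI[OF that that])
       (use two_rho_le_1 mult_right_mono[OF two_rho_le_1, of "real (n k)"] in auto)
  from trig_poly_sum[OF this, of B "\<lambda>x. x"] show ?thesis
    by (simp add: block_sum_def)
qed

text \<open>Products of cosines have frequencies \<open>n a \<plusminus> n b\<close>. For distinct
  indices the Hadamard condition keeps the difference above \<open>2 * \<rho>\<close> times the
  larger term, so constants come only from the diagonal, each squared cosine contributing
  1/2.\<close>

lemma trig_poly_block_sum_sq:
  assumes "finite B" "B \<subseteq> {1..}"
  shows "trig_poly (block_freqs B) (\<lambda>x. of_real ((block_sum c B x)\<^sup>2 - (\<Sum>k\<in>B. (c k)\<^sup>2) / 2))"
proof -
  let ?\<theta> = "\<lambda>a x. 2 * pi * real (n a) * x"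
  \<comment> \<open>The diagonal constants are subtracted term by term, so that each
    \<open>?g a b\<close> separately has no frequency 0.\<close>
  let ?g = "\<lambda>a b x. c a * c b * (cos (?\<theta> a x) * cos (?\<theta> b x)) - (if a = b then (c a)\<^sup>2 / 2 else 0)"
  have le: "2 * \<rho> * n k \<le> n k" for k
    using mult_right_mono[OF two_rho_le_1, of "real (n k)"] by simp
  have off: "trig_poly (block_freqs B) (\<lambda>x. complex_of_real (?g a b x))"
    if ab: "a \<in> B" "b \<in> B" "b < a" for a b
  proof -
    have ba: "1 \<le> b" using ab assms by auto
    have nb: "n b \<le> n a"
      using growth_less[OF ba \<open>b < a\<close>] mult_right_mono[of 1 q "real (n b)"] q by linarith
    have "trig_poly (block_freqs B) (\<lambda>x. of_real (c a * c b / 2) * of_real (cos (2 * pi * of_int (int (n a) - int (n b)) * x))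
        + of_real (c a * c b / 2) * of_real (cos (2 * pi * of_int (int (n a) + int (n b)) * x)))"
      using nb diff_ge[OF ba \<open>b < a\<close>] le[of a]
      by (intro trig_poly_plus trig_poly_cos block_freqsI[OF ab(1) ab(1)]) auto
    then show ?thesis
      by (rule trig_poly_cong)
         (use ab in \<open>simp add: cos_times_cos algebra_simps flip: of_real_mult of_real_add\<close>)
  qed
  have term_tp: "trig_poly (block_freqs B) (\<lambda>x. complex_of_real (?g a b x))" if ab: "a \<in> B" "b \<in> B" for a b
  proof -
    consider "b < a" | "a < b" | "a = b" by linarith
    then show ?thesis
    proof cases
      case 1
      then show ?thesis by (rule off[OF ab])
    next
      case 2
      from off[OF ab(2,1) this] 2 show ?thesis
        by (elim trig_poly_cong) (simp add: mult_ac)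
    next
      case 3
      have "trig_poly (block_freqs B) (\<lambda>x. of_real ((c a)\<^sup>2 / 2) * of_real (cos (2 * pi * of_int (2 * int (n a)) * x)))"
        using le[of a] by (intro trig_poly_cos block_freqsI[OF ab(1) ab(1)]) auto
      then show ?thesis
      proof (rule trig_poly_cong)
        fix x
        have "(cos (?\<theta> a x))\<^sup>2 = (1 + cos (2 * ?\<theta> a x)) / 2"
          using cos_double_cos[of "?\<theta> a x"] by simp
        then show "complex_of_real ((c a)\<^sup>2 / 2) * complex_of_real (cos (2 * pi * real_of_int (2 * int (n a)) * x))
           = complex_of_real (?g a b x)"
          using 3 by (simp add: algebra_simps add_divide_distrib power2_eq_square flip: of_real_mult of_real_diff)
      qed
    qed
  qed
  have "trig_poly (block_freqs B) (\<lambda>x. \<Sum>a\<in>B. \<Sum>b\<in>B. complex_of_real (?g a b x))"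
    by (intro trig_poly_sum term_tp)
  then show ?thesis
  proof (rule trig_poly_cong)
    fix x
    have "(\<Sum>a\<in>B. \<Sum>b\<in>B. ?g a b x) = (\<Sum>a\<in>B. \<Sum>b\<in>B. c a * c b * (cos (?\<theta> a x) * cos (?\<theta> b x))) - (\<Sum>a\<in>B. (c a)\<^sup>2 / 2)"
      using assms(1) by (simp add: sum_subtractf)
    also have "(\<Sum>a\<in>B. \<Sum>b\<in>B. c a * c b * (cos (?\<theta> a x) * cos (?\<theta> b x))) = (block_sum c B x)\<^sup>2"
      by (simp add: block_sum_def power2_eq_square sum_product mult_ac)
    finally show "(\<Sum>a\<in>B. \<Sum>b\<in>B. complex_of_real (?g a b x)) = complex_of_real ((block_sum c B x)\<^sup>2 - (\<Sum>k\<in>B. (c k)\<^sup>2) / 2)"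
      by (simp only: of_real_sum[symmetric] sum_divide_distrib)
  qed
qed

lemma zero_notin_block_freqs: "B \<subseteq> {1..} \<Longrightarrow> 0 \<notin> block_freqs B"
  using rho_pos pos by (auto simp: block_freqs_def not_le)

lemma block_sum_continuous [continuous_intros]: "continuous_on A (block_sum c B)"
  unfolding block_sum_def by (intro continuous_intros)

lemma block_sum_measurable [measurable]: "block_sum c B \<in> borel_measurable borel"
  by (intro borel_measurable_continuous_onI block_sum_continuous)

text \<open>Lets the central limit theorem discard the gap indices in mean square.\<close>

lemma second_moment:
  assumes "finite B" "B \<subseteq> {1..}"
  shows "(LINT x|unit_interval_space. (block_sum c B x)\<^sup>2) = (\<Sum>k\<in>B. (c k)\<^sup>2) / 2"
proof -
  let ?s = "(\<Sum>k\<in>B. (c k)\<^sup>2) / 2"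
  have "complex_of_real (LINT x|unit_interval_space. (block_sum c B x)\<^sup>2 - ?s) = 0"
    using trig_poly_integral_zero[OF trig_poly_block_sum_sq[OF assms, of c] zero_notin_block_freqs[OF assms(2)]]
    by (simp only: integral_complex_of_real)
  then have "(LINT x|unit_interval_space. (block_sum c B x)\<^sup>2 - ?s) = 0"
    by (simp only: of_real_eq_0_iff)
  moreover have "(LINT x|unit_interval_space. (block_sum c B x)\<^sup>2 - ?s) =
     (LINT x|unit_interval_space. (block_sum c B x)\<^sup>2) - (LINT x|unit_interval_space. ?s)"
    by (intro Bochner_Integration.integral_diff unit_interval_integrable continuous_intros)
  ultimately show ?thesis using U.prob_space by simp
qed

text \<open>\<open>z\<close> is complex so that one identity serves both uses: \<open>z = 1\<close>
  for exponential moments and \<open>z = \<i>\<close> for characteristic functions. The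
  factorisation is exact; all approximation happens later, when the factors are compared with
  exponentials.\<close>

lemma integral_prod_blocks:
  fixes blk :: "nat \<Rightarrow> nat" and z :: complex
  assumes B: "finite B" "B \<subseteq> {1..}"
    and sep: "\<And>k l. k \<in> B \<Longrightarrow> l \<in> B \<Longrightarrow> blk k < blk l \<Longrightarrow> K * n k \<le> n l"
  defines "Bj \<equiv> \<lambda>j. {k \<in> B. blk k = j}"
  shows "(LINT x|unit_interval_space. (\<Prod>j<J. 1 + z * block_sum c (Bj j) x + z\<^sup>2 * (block_sum c (Bj j) x)\<^sup>2 / 2))
     = (\<Prod>j<J. 1 + z\<^sup>2 * (\<Sum>k\<in>Bj j. (c k)\<^sup>2) / 4)"
proof -
  let ?T = "\<lambda>j. block_sum c (Bj j)"
  let ?s = "\<lambda>j. (\<Sum>k\<in>Bj j. (c k)\<^sup>2)"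
  let ?h = "\<lambda>j x. z * of_real (?T j x) + z\<^sup>2 / 2 * of_real ((?T j x)\<^sup>2 - ?s j / 2)"
  \<comment> \<open>Frequencies accumulated before block \<open>j\<close> are described through what
    is still to come: they must be small against every element of block \<open>j\<close> or later.
    Empty labels therefore cost nothing.\<close>
  let ?F = "\<lambda>j. {m::int. \<forall>k\<in>B. j \<le> blk k \<longrightarrow> \<bar>m\<bar> \<le> \<rho> * n k}"
  have Bj: "finite (Bj j)" "Bj j \<subseteq> {1..}" for j using B by (auto simp: Bj_def)
  have "(LINT x|unit_interval_space. (\<Prod>j<J. (1 + z\<^sup>2 * ?s j / 4) + ?h j x)) = (\<Prod>j<J. 1 + z\<^sup>2 * ?s j / 4)"
  proof (rule trig_poly_prod_integral[THEN conjunct2])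
    show "trig_poly (block_freqs (Bj j)) (?h j)" for j
      by (intro trig_poly_plus trig_poly_scale trig_poly_block_sum trig_poly_block_sum_sq Bj)
    show "0 \<in> ?F 0" using rho_pos by auto
    show "?F j \<subseteq> ?F (Suc j)" for j by auto
    fix j m m' assume m: "m \<in> ?F j" and m': "m' \<in> block_freqs (Bj j)"
    obtain a b where ab: "a \<in> B" "blk a = j" "b \<in> B" "blk b = j"
      "2 * \<rho> * n a \<le> \<bar>m'\<bar>" "\<bar>m'\<bar> \<le> 2 * real (n b)"
      using m' by (auto simp: block_freqs_def Bj_def)
    \<comment> \<open>The accumulated frequency is at most \<open>\<rho> * n a\<close> and the new
      one at least \<open>2 * \<rho> * n a\<close>, so they cannot cancel; the bound by
      \<open>n b\<close> controls the sum for later blocks.\<close>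
    have ma: "\<bar>m\<bar> \<le> \<rho> * n a" and mb: "\<bar>m\<bar> \<le> \<rho> * n b" using m ab by auto
    have "\<rho> * n a > 0" using ab B pos[of a] rho_pos by auto
    then have "m + m' \<noteq> 0" using ma ab(5) by linarith
    moreover have "\<bar>m + m'\<bar> \<le> \<rho> * n k" if k: "k \<in> B" "Suc j \<le> blk k" for k
    proof -
      have "real_of_int \<bar>m + m'\<bar> \<le> (\<rho> + 2) * n b"
        using mb ab(6) by (simp add: algebra_simps)
      also have "\<dots> = \<rho> * (K * n b)" using rho_pos by (simp add: K_def)
      also have "\<dots> \<le> \<rho> * n k"
        using sep[of b k] ab k rho_pos by (intro mult_left_mono) auto
      finally show ?thesis .
    qed
    ultimately show "m + m' \<in> ?F (Suc j) - {0}" by auto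
  qed
  then show ?thesis by (simp add: algebra_simps diff_divide_distrib)
qed

end

section \<open>Exponential moments and characteristic functions\<close>

text \<open>The error is made multiplicative so that it survives a product over blocks. The Taylor
  remainder is at most \<open>\<bar>t\<bar> ^ 3 / 2\<close>, and both \<open>exp t\<close> and the
  quadratic are at least 1/2 in this range, which turns it into a factor
  \<open>1 + \<bar>t\<bar> ^ 3\<close>.\<close>

lemma exp_quadratic_bounds:
  fixes t :: real
  assumes "\<bar>t\<bar> \<le> 1 / 2"
  shows "exp t \<le> (1 + t + t\<^sup>2 / 2) * exp (\<bar>t\<bar> ^ 3)"
    and "1 + t + t\<^sup>2 / 2 \<le> exp t * exp (\<bar>t\<bar> ^ 3)"
    and "0 < 1 + t + t\<^sup>2 / 2"
proof -
  let ?Q = "1 + t + t\<^sup>2 / 2"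
  obtain u where u: "\<bar>u\<bar> \<le> \<bar>t\<bar>" "exp t = (\<Sum>m<3. t ^ m / fact m) + exp u / fact 3 * t ^ 3"
    using Maclaurin_exp_le[of t 3] by auto
  have e: "exp t = ?Q + exp u / 6 * t ^ 3"
    using u(2) by (simp add: eval_nat_numeral fact_numeral)
  have eh: "exp (1 / 2 :: real) \<le> 2"
  proof -
    have "exp (1/2::real) * exp (1/2) \<le> 3" using exp_le by (simp flip: exp_add)
    moreover have "exp (1/2::real) * exp (1/2) > 2 * 2" if "exp (1/2::real) > 2"
      using that by (intro mult_strict_mono) auto
    ultimately show ?thesis by linarith
  qed
  have eu: "exp u \<le> 2" using u(1) assms eh by (intro order_trans[OF _ eh]) auto
  have et: "exp t \<ge> 1 / 2"
  proof -
    have "exp (- t) \<le> 2" using assms by (intro order_trans[OF _ eh]) auto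
    then show ?thesis by (simp add: exp_minus field_simps)
  qed
  have Q: "?Q \<ge> 1 / 2" using assms zero_le_power2[of t] unfolding abs_le_iff by linarith
  then show "0 < ?Q" by linarith
  have r: "\<bar>exp u / 6 * t ^ 3\<bar> \<le> \<bar>t\<bar> ^ 3 / 2"
    using eu mult_right_mono[of "exp u" 3 "\<bar>t\<bar> ^ 3"] by (simp add: abs_mult power_abs)
  have x: "1 + \<bar>t\<bar> ^ 3 \<le> exp (\<bar>t\<bar> ^ 3)" using exp_ge_add_one_self by blast
  have "exp t \<le> ?Q * (1 + \<bar>t\<bar> ^ 3)"
    using e r mult_right_mono[OF Q, of "\<bar>t\<bar> ^ 3"] by (simp add: distrib_left)
  also have "\<dots> \<le> ?Q * exp (\<bar>t\<bar> ^ 3)" using x Q by (intro mult_left_mono) auto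
  finally show "exp t \<le> ?Q * exp (\<bar>t\<bar> ^ 3)" .
  have "?Q \<le> exp t * (1 + \<bar>t\<bar> ^ 3)"
    using e r mult_right_mono[OF et, of "\<bar>t\<bar> ^ 3"] by (simp add: distrib_left)
  also have "\<dots> \<le> exp t * exp (\<bar>t\<bar> ^ 3)" using x by (intro mult_left_mono) auto
  finally show "?Q \<le> exp t * exp (\<bar>t\<bar> ^ 3)" .
qed

lemma cis_quadratic_bound:
  "norm (1 + \<i> * complex_of_real t + \<i>\<^sup>2 * (complex_of_real t)\<^sup>2 / 2 - cis t) \<le> \<bar>t\<bar> ^ 3"
proof -
  have "norm (1 + \<i> * complex_of_real t + \<i>\<^sup>2 * (complex_of_real t)\<^sup>2 / 2 - cis t) \<le> \<bar>t\<bar> ^ 3 / 6"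
    using iexp_approx1[of t 2]
    by (simp add: eval_nat_numeral fact_numeral norm_minus_commute cis_conv_exp power_mult_distrib)
  also have "\<dots> \<le> \<bar>t\<bar> ^ 3" by simp
  finally show ?thesis .
qed

lemma exp_minus_quadratic_bound:
  fixes y :: real
  assumes "0 \<le> y"
  shows "\<bar>1 - y - exp (- y)\<bar> \<le> y\<^sup>2"
proof -
  have "exp (- y) \<le> inverse (1 + y)"
    using exp_ge_add_one_self[of y] assms by (simp add: exp_minus le_imp_inverse_le)
  also have "\<dots> \<le> 1 - y + y\<^sup>2"
  proof -
    have "1 \<le> (1 - y + y\<^sup>2) * (1 + y)" using assms by (simp add: algebra_simps power2_eq_square)
    then show ?thesis using assms by (simp add: field_simps)
  qed
  finally show ?thesis using exp_ge_add_one_self[of "- y"] by linarith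
qed

lemma norm_prod_diff_unimodular:
  fixes a b :: "nat \<Rightarrow> complex"
  assumes "\<And>i. i \<in> I \<Longrightarrow> norm (a i) = 1" "\<And>i. i \<in> I \<Longrightarrow> norm (b i - a i) \<le> e i"
  shows "norm (prod b I - prod a I) \<le> exp (sum e I) - 1"
proof -
  have fin: ?thesis if fin: "finite I"
  proof -
    have a0: "a i \<noteq> 0" if "i \<in> I" for i using assms(1)[OF that] by auto
    have "prod b I = prod a I * (\<Prod>i\<in>I. 1 + (b i - a i) / a i)"
      unfolding prod.distrib[symmetric] using a0 by (intro prod.cong) (auto simp: field_simps)
    then have "prod b I - prod a I = prod a I * ((\<Prod>i\<in>I. 1 + (b i - a i) / a i) - 1)"
      by (simp add: algebra_simps)
    moreover have "norm (prod a I) = 1" using assms(1) by (simp add: prod_norm[symmetric])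
    ultimately have "norm (prod b I - prod a I) = norm ((\<Prod>i\<in>I. 1 + (b i - a i) / a i) - 1)"
      by (simp add: norm_mult)
    also have "\<dots> \<le> (\<Prod>i\<in>I. 1 + norm ((b i - a i) / a i)) - 1"
      using norm_prod_minus1_le_prod_minus1[of "\<lambda>i. (b i - a i) / a i" I] by simp
    also have "(\<Prod>i\<in>I. 1 + norm ((b i - a i) / a i)) \<le> (\<Prod>i\<in>I. exp (e i))"
    proof (intro prod_mono conjI)
      fix i assume "i \<in> I"
      then have "norm ((b i - a i) / a i) \<le> e i" using assms by (simp add: norm_divide)
      then show "1 + norm ((b i - a i) / a i) \<le> exp (e i)"
        using exp_ge_add_one_self[of "e i"] by linarith
    qed auto
    also have "\<dots> = exp (sum e I)" by (simp add: exp_sum fin)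
    finally show ?thesis by simp
  qed
  show ?thesis by (cases "finite I") (use fin in auto)
qed

context lacunary
begin

text \<open>The labelling is hidden behind an existential quantifier, so that the notion passes to
  subsets and forgets the shift that produced it.\<close>

definition separated :: "nat \<Rightarrow> nat set \<Rightarrow> bool" where
  "separated L B \<longleftrightarrow> finite B \<and> B \<subseteq> {1..} \<and> (\<exists>blk::nat \<Rightarrow> nat.
     (\<forall>k\<in>B. \<forall>l\<in>B. blk k < blk l \<longrightarrow> K * n k \<le> n l) \<and> (\<forall>j. card {k \<in> B. blk k = j} \<le> L))"

lemma separated_subset:
  assumes "separated L B" "B' \<subseteq> B"
  shows "separated L B'"
proof -
  obtain blk :: "nat \<Rightarrow> nat" where *: "finite B" "B \<subseteq> {1..}"
    "\<forall>k\<in>B. \<forall>l\<in>B. blk k < blk l \<longrightarrow> K * n k \<le> n l" "\<And>j. card {k \<in> B. blk k = j} \<le> L"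
    using assms(1) unfolding separated_def by blast
  have "card {k \<in> B'. blk k = j} \<le> L" for j
    using assms(2) *(1) by (intro order_trans[OF card_mono *(4)[of j]]) auto
  then show ?thesis
    unfolding separated_def using * assms(2) by (intro conjI exI[of _ blk]) (blast intro: finite_subset)+
qed

text \<open>Everything is charged to one cubic quantity through the largest weight \<open>m\<close>:
  the block sum is at most \<open>L * m\<close>, and \<open>m ^ 3\<close> is below the sum of cubes.
  Also \<open>y \<le> (L * m)\<^sup>2\<close>, so \<open>y\<^sup>2\<close> is at most the fourth
  power of \<open>L * m\<close>, hence at most its cube.\<close>

lemma block_estimates:
  fixes c :: "nat \<Rightarrow> real" and L :: nat
  assumes B: "finite B" "card B \<le> L"
    and c: "\<And>k. k \<in> B \<Longrightarrow> L * \<bar>c k\<bar> \<le> 1 / 2"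
  defines "e \<equiv> real L ^ 3 * (\<Sum>k\<in>B. \<bar>c k\<bar> ^ 3)" and "y \<equiv> (\<Sum>k\<in>B. (c k)\<^sup>2) / 4"
  shows "\<bar>block_sum c B x\<bar> \<le> 1 / 2" "\<bar>block_sum c B x\<bar> ^ 3 \<le> e" "0 \<le> y" "y \<le> 1" "y\<^sup>2 \<le> e"
proof -
  obtain m where m: "0 \<le> m" "real L * m \<le> 1 / 2" "\<And>k. k \<in> B \<Longrightarrow> \<bar>c k\<bar> \<le> m" "m ^ 3 \<le> (\<Sum>k\<in>B. \<bar>c k\<bar> ^ 3)" "L = 0 \<Longrightarrow> m = 0"
  proof (cases "B = {}")
    case True
    then show ?thesis using that[of 0] by simp
  next
    case False
    define m where "m = Max ((\<lambda>k. \<bar>c k\<bar>) ` B)"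
    have "m \<in> (\<lambda>k. \<bar>c k\<bar>) ` B" unfolding m_def using B False by (intro Max_in) auto
    then obtain k where k: "k \<in> B" "m = \<bar>c k\<bar>" by auto
    have "m ^ 3 \<le> (\<Sum>k\<in>B. \<bar>c k\<bar> ^ 3)"
      unfolding k(2) using B k by (intro member_le_sum[of k B "\<lambda>k. \<bar>c k\<bar> ^ 3"]) auto
    moreover have "L \<noteq> 0" using B False by auto
    ultimately show ?thesis using that[of m] k c[of k] B by (auto simp: m_def)
  qed
  have "\<bar>block_sum c B x\<bar> \<le> (\<Sum>k\<in>B. \<bar>c k * cos (2 * pi * real (n k) * x)\<bar>)"
    unfolding block_sum_def by (rule sum_abs)
  also have "\<dots> \<le> (\<Sum>k\<in>B. m)"
  proof (rule sum_mono)
    fix k assume "k \<in> B"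
    have "\<bar>c k\<bar> * \<bar>cos (2 * pi * real (n k) * x)\<bar> \<le> m * 1"
      using m \<open>k \<in> B\<close> by (intro mult_mono) auto
    then show "\<bar>c k * cos (2 * pi * real (n k) * x)\<bar> \<le> m" by (simp add: abs_mult)
  qed
  also have "\<dots> \<le> L * m" using B m by (simp add: mult_right_mono)
  finally have T: "\<bar>block_sum c B x\<bar> \<le> L * m" .
  then show "\<bar>block_sum c B x\<bar> \<le> 1 / 2" using m by linarith
  have Lm: "(L * m) ^ 3 \<le> e" unfolding e_def power_mult_distrib using m by (intro mult_left_mono) auto
  have "\<bar>block_sum c B x\<bar> ^ 3 \<le> (L * m) ^ 3" using T by (intro power_mono) auto
  then show "\<bar>block_sum c B x\<bar> ^ 3 \<le> e" using Lm by linarith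
  show y0: "0 \<le> y" unfolding y_def by (simp add: sum_nonneg)
  have "(\<Sum>k\<in>B. (c k)\<^sup>2) \<le> (\<Sum>k\<in>B. m\<^sup>2)" using m by (intro sum_mono) (metis power2_abs power_mono abs_ge_zero)
  also have "\<dots> \<le> L * m\<^sup>2" using B by (simp add: mult_right_mono)
  finally have "y \<le> real L * m\<^sup>2 / 4" by (simp add: y_def)
  moreover have "0 \<le> real L * m\<^sup>2" by simp
  ultimately have "y \<le> real L * m\<^sup>2" by linarith
  then have y1: "y \<le> (L * m) * m" by (simp add: power2_eq_square mult_ac)
  show "y\<^sup>2 \<le> e" "y \<le> 1"
  proof -
    have L: "L = 0 \<or> real L \<ge> 1" by auto
    have mL: "(L * m) * m \<le> (L * m) * (L * m)"
      using L m mult_right_mono[of 1 "real L" m] by (auto intro!: mult_left_mono)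
    also have "\<dots> \<le> (1/2) * (1/2)" using m by (intro mult_mono) auto
    finally show "y \<le> 1" using y1 by linarith
    have "y * y \<le> ((L * m) * (L * m)) * ((L * m) * (L * m))"
      using y0 y1 mL by (intro mult_mono) auto
    also have "\<dots> \<le> (L * m) ^ 3 * 1"
      using m mult_left_mono[of "L * m" 1 "(L * m) ^ 3"] by (simp add: eval_nat_numeral mult_ac)
    finally show "y\<^sup>2 \<le> e" using Lm by (simp add: power2_eq_square)
  qed
qed

lemma block_sum_group:
  assumes "finite B" "\<And>k. k \<in> B \<Longrightarrow> blk k < (J::nat)"
  shows "(\<Sum>j<J. sum f {k \<in> B. blk k = j}) = sum f B"
  using assms by (intro sum.group) auto

text \<open>Here \<open>y\<close> is half the variance. Each comparison costs at most one
  \<open>e\<close>. Upper bound: exponential against quadratic factor, then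
  \<open>1 + y \<le> exp y\<close> for free. Lower bound: a second \<open>e\<close> for
  \<open>1 + y\<close> against \<open>exp y\<close>. Characteristic function:
  \<open>exp e - 1\<close> for \<open>cis\<close> against the quadratic factors, and
  \<open>e\<close> for \<open>1 - y\<close> against \<open>exp (- y)\<close>.\<close>

lemma
  assumes B: "separated L B" and c: "\<And>k. k \<in> B \<Longrightarrow> L * \<bar>c k\<bar> \<le> 1 / 2"
  defines "e \<equiv> real L ^ 3 * (\<Sum>k\<in>B. \<bar>c k\<bar> ^ 3)" and "y \<equiv> (\<Sum>k\<in>B. (c k)\<^sup>2) / 4"
  shows exp_moment_upper: "(LINT x|unit_interval_space. exp (block_sum c B x)) \<le> exp (y + e)"
    and exp_moment_lower: "exp (y - 2 * e) \<le> (LINT x|unit_interval_space. exp (block_sum c B x))"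
    and char_bound: "norm ((LINT x|unit_interval_space. cis (block_sum c B x)) - complex_of_real (exp (- y))) \<le> exp e - 1 + e"
proof -
  obtain blk :: "nat \<Rightarrow> nat" where *: "finite B" "B \<subseteq> {1..}"
    "\<And>k l. k \<in> B \<Longrightarrow> l \<in> B \<Longrightarrow> blk k < blk l \<Longrightarrow> K * n k \<le> n l" "\<And>j. card {k \<in> B. blk k = j} \<le> L"
    using B unfolding separated_def by blast
  obtain J where J: "\<And>k. k \<in> B \<Longrightarrow> blk k < J"
    using finite_nat_bounded[OF finite_imageI[OF *(1), of blk]] by blast
  define Bj where "Bj j = {k \<in> B. blk k = j}" for j
  define T where "T j = block_sum c (Bj j)" for j
  define ej where "ej j = real L ^ 3 * (\<Sum>k\<in>Bj j. \<bar>c k\<bar> ^ 3)" for j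
  define yj where "yj j = (\<Sum>k\<in>Bj j. (c k)\<^sup>2) / 4" for j
  note grp = block_sum_group[where blk = blk, OF *(1) J, folded Bj_def]
  have est: "\<bar>T j x\<bar> \<le> 1 / 2" "\<bar>T j x\<bar> ^ 3 \<le> ej j" "0 \<le> yj j" "yj j \<le> 1" "(yj j)\<^sup>2 \<le> ej j" for j x
    using block_estimates[of "Bj j" L c] *(1,4) c
    unfolding T_def ej_def yj_def by (auto simp: Bj_def)
  have se: "(\<Sum>j<J. ej j) = e" unfolding ej_def e_def by (simp add: grp flip: sum_distrib_left)
  have sy: "(\<Sum>j<J. yj j) = y" unfolding yj_def y_def by (simp add: grp flip: sum_divide_distrib)
  have sT: "(\<Sum>j<J. T j x) = block_sum c B x" for x by (simp add: T_def block_sum_def grp)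
  have Tcont: "continuous_on UNIV (T j)" for j unfolding T_def by (rule block_sum_continuous)
  define Q where "Q x = (\<Prod>j<J. 1 + T j x + (T j x)\<^sup>2 / 2)" for x
  note ident = integral_prod_blocks[where blk = blk and c = c and J = J, OF *(1,2,3), folded Bj_def, folded T_def]
  have intQ: "(LINT x|unit_interval_space. Q x) = (\<Prod>j<J. 1 + yj j)"
  proof -
    have "complex_of_real (LINT x|unit_interval_space. Q x) = complex_of_real (\<Prod>j<J. 1 + yj j)"
      using ident[of 1] by (simp add: Q_def yj_def flip: integral_complex_of_real)
    then show ?thesis by (simp only: of_real_eq_iff)
  qed
  have Qi: "integrable unit_interval_space Q"
    unfolding Q_def by (intro unit_interval_integrable continuous_intros Tcont) auto
  have Ei: "integrable unit_interval_space (\<lambda>x. exp (block_sum c B x))"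
    by (intro unit_interval_integrable continuous_intros)
  have expS: "exp (block_sum c B x) = (\<Prod>j<J. exp (T j x))" for x
    by (simp add: exp_sum flip: sT)
  have expe: "exp e = (\<Prod>j<J. exp (ej j))" by (simp add: exp_sum flip: se)
  have T3: "exp (\<bar>T j x\<bar> ^ 3) \<le> exp (ej j)" for j x using est by simp
  have "exp (block_sum c B x) \<le> Q x * exp e" for x
    unfolding expS Q_def expe prod.distrib[symmetric]
    by (intro prod_mono conjI order_trans[OF exp_quadratic_bounds(1)[OF est(1)]] mult_left_mono T3
        less_imp_le[OF exp_quadratic_bounds(3)[OF est(1)]]) auto
  then have "(LINT x|unit_interval_space. exp (block_sum c B x)) \<le> (LINT x|unit_interval_space. Q x * exp e)"
    by (intro integral_mono Ei integrable_mult_left Qi)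
  also have "\<dots> = (\<Prod>j<J. 1 + yj j) * exp e" by (simp add: intQ)
  also have "\<dots> \<le> exp y * exp e"
    using est exp_ge_add_one_self
    by (intro mult_right_mono) (auto simp: exp_sum simp flip: sy intro!: prod_mono add_nonneg_nonneg)
  finally show "(LINT x|unit_interval_space. exp (block_sum c B x)) \<le> exp (y + e)" by (simp add: exp_add)
  have "Q x \<le> exp (block_sum c B x) * exp e" for x
    unfolding expS Q_def expe prod.distrib[symmetric]
    by (intro prod_mono conjI order_trans[OF exp_quadratic_bounds(2)[OF est(1)]] mult_left_mono T3
        less_imp_le[OF exp_quadratic_bounds(3)[OF est(1)]]) auto
  then have "(LINT x|unit_interval_space. Q x) \<le> (LINT x|unit_interval_space. exp (block_sum c B x) * exp e)"
    by (intro integral_mono Qi integrable_mult_left Ei)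
  then have low: "(\<Prod>j<J. 1 + yj j) \<le> (LINT x|unit_interval_space. exp (block_sum c B x)) * exp e" by (simp add: intQ)
  \<comment> \<open>For \<open>y\<close> in the unit interval \<open>ln (1 + y)\<close> is at least
    \<open>y - y\<^sup>2\<close>, and the square is absorbed by the cubic error of the same
    block.\<close>
  have "exp (y - e) = (\<Prod>j<J. exp (yj j - ej j))"
    by (simp add: sum_subtractf sy se flip: exp_sum)
  also have "\<dots> \<le> (\<Prod>j<J. 1 + yj j)"
  proof (intro prod_mono conjI)
    fix j
    have "yj j - ej j \<le> ln (1 + yj j)"
      using ln_one_plus_pos_lower_bound[of "yj j"] est(3)[of j] est(4)[of j] est(5)[of j] by linarith
    then show "exp (yj j - ej j) \<le> 1 + yj j" using est(3)[of j] by (simp add: ln_ge_iff)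
  qed auto
  finally have "exp (y - e) \<le> (LINT x|unit_interval_space. exp (block_sum c B x)) * exp e" using low by linarith
  then have "exp (y - e) * exp (- e) \<le> (LINT x|unit_interval_space. exp (block_sum c B x)) * exp e * exp (- e)"
    by (intro mult_right_mono) auto
  then show "exp (y - 2 * e) \<le> (LINT x|unit_interval_space. exp (block_sum c B x))"
    by (simp add: mult.assoc flip: exp_add)
  define R where "R x = (\<Prod>j<J. 1 + \<i> * T j x + \<i>\<^sup>2 * (complex_of_real (T j x))\<^sup>2 / 2)" for x
  have intR: "(LINT x|unit_interval_space. R x) = complex_of_real (\<Prod>j<J. 1 - yj j)"
    using ident[of \<i>] by (simp add: R_def yj_def)
  have Ri: "integrable unit_interval_space R"
    unfolding R_def by (intro unit_interval_integrable continuous_intros Tcont) auto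
  have Ci: "integrable unit_interval_space (\<lambda>x. cis (block_sum c B x))"
    by (intro unit_interval_integrable continuous_intros)
  have cisS: "cis (block_sum c B x) = (\<Prod>j<J. cis (T j x))" for x
    by (simp add: cis_conv_exp exp_sum sum_distrib_left flip: sT)
  have "norm (R x - cis (block_sum c B x)) \<le> exp e - 1" for x
    unfolding R_def cisS se[symmetric]
    by (rule norm_prod_diff_unimodular, simp, rule order_trans[OF cis_quadratic_bound est(2)])
  then have RC: "norm (cis (block_sum c B x) - R x) \<le> exp e - 1" for x
    by (simp only: norm_minus_commute)
  have "norm ((LINT x|unit_interval_space. cis (block_sum c B x)) - (LINT x|unit_interval_space. R x))
      = norm (LINT x|unit_interval_space. cis (block_sum c B x) - R x)"
    using Ci Ri by simp
  also have "\<dots> \<le> (LINT x|unit_interval_space. norm (cis (block_sum c B x) - R x))"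
    by (rule integral_norm_bound)
  also have "\<dots> \<le> (LINT x|unit_interval_space. exp e - 1)"
    using Ci Ri by (intro integral_mono RC integrable_norm) auto
  also have "\<dots> = exp e - 1" using U.prob_space by simp
  finally have 1: "norm ((LINT x|unit_interval_space. cis (block_sum c B x)) - (\<Prod>j<J. 1 - yj j)) \<le> exp e - 1"
    by (simp only: intR)
  have "norm ((\<Prod>j<J. 1 - yj j) - (\<Prod>j<J. exp (- yj j))) \<le> (\<Sum>j<J. norm ((1 - yj j) - exp (- yj j)))"
    using est by (intro norm_prod_diff) (auto simp: abs_le_iff intro: order_trans[OF _ est(3)])
  also have "\<dots> \<le> (\<Sum>j<J. ej j)"
    unfolding real_norm_def by (intro sum_mono order_trans[OF exp_minus_quadratic_bound[OF est(3)] est(5)])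
  finally have "\<bar>(\<Prod>j<J. 1 - yj j) - exp (- y)\<bar> \<le> e"
    by (simp add: se exp_sum flip: sum_negf sy)
  then have 2: "norm (complex_of_real (\<Prod>j<J. 1 - yj j) - complex_of_real (exp (- y))) \<le> e"
    by (simp only: norm_of_real of_real_diff[symmetric])
  show "norm ((LINT x|unit_interval_space. cis (block_sum c B x)) - complex_of_real (exp (- y))) \<le> exp e - 1 + e"
    by (rule norm_diff_triangle_le[OF 1 2])
qed

end

lemma card_shifts:
  assumes "L \<le> (P::nat)"
  shows "card {s \<in> {..<P}. (k + s) mod P < L} = L"
proof -
  have inj: "inj_on (\<lambda>s. (k + s) mod P) {..<P}"
  proof (rule linorder_inj_onI')
    fix s t assume st: "s \<in> {..<P}" "t \<in> {..<P}" "s < t"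
    show "(k + s) mod P \<noteq> (k + t) mod P"
    proof
      assume "(k + s) mod P = (k + t) mod P"
      then have "P dvd (k + t) - (k + s)" using st by (metis mod_eq_dvd_iff_nat add_le_cancel_left less_imp_le)
      then show False using st by (auto dest: dvd_imp_le)
    qed
  qed
  moreover have "(\<lambda>s. (k + s) mod P) ` {..<P} \<subseteq> {..<P}" by auto
  ultimately have "(\<lambda>s. (k + s) mod P) ` {..<P} = {..<P}"
    by (intro endo_inj_surj) auto
  then have "{..<L} \<subseteq> (\<lambda>s. (k + s) mod P) ` {..<P}" using assms by auto
  then have "(\<lambda>s. (k + s) mod P) ` {s \<in> {..<P}. (k + s) mod P < L} = {..<L}" by blast
  moreover have "card ((\<lambda>s. (k + s) mod P) ` {s \<in> {..<P}. (k + s) mod P < L}) =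
      card {s \<in> {..<P}. (k + s) mod P < L}"
    by (rule card_image[OF inj_on_subset[OF inj]]) auto
  ultimately show ?thesis by simp
qed

lemma sum_shifts:
  fixes f :: "nat \<Rightarrow> real" and L P :: nat
  assumes "L \<le> P" "finite A"
  shows "(\<Sum>s<P. sum f {k \<in> A. (k + s) mod P < L}) = L * sum f A"
proof -
  have "(\<Sum>s<P. sum f {k \<in> A. (k + s) mod P < L}) = (\<Sum>s<P. \<Sum>k\<in>A. if (k + s) mod P < L then f k else 0)"
    using assms by (simp add: sum.If_cases Int_def)
  also have "\<dots> = (\<Sum>k\<in>A. \<Sum>s<P. if (k + s) mod P < L then f k else 0)" by (rule sum.swap)
  also have "\<dots> = (\<Sum>k\<in>A. L * f k)"
  proof (rule sum.cong)
    fix k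
    have "(\<Sum>s<P. if (k + s) mod P < L then f k else 0) = card ({..<P} \<inter> {s. (k + s) mod P < L}) * f k"
      by (simp add: sum.If_cases)
    also have "{..<P} \<inter> {s. (k + s) mod P < L} = {s \<in> {..<P}. (k + s) mod P < L}" by auto
    finally show "(\<Sum>s<P. if (k + s) mod P < L then f k else 0) = L * f k"
      using card_shifts[OF assms(1)] by simp
  qed simp
  finally show ?thesis by (simp add: sum_distrib_left)
qed

lemma exists_good_shift:
  assumes "finite A" "0 < L + g"
  shows "\<exists>s<L + g. (L + g) * card {k \<in> A. \<not> (k + s) mod (L + g) < L} \<le> g * card A"
proof (rule ccontr)
  assume contra: "\<not> ?thesis"
  let ?B = "\<lambda>s. {k \<in> A. (k + s) mod (L + g) < L}" and ?R = "\<lambda>s. {k \<in> A. \<not> (k + s) mod (L + g) < L}"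
  have "card A = card (?B s) + card (?R s)" for s
    using assms by (subst card_Un_disjoint[symmetric]) (auto intro: arg_cong[where f = card])
  then have "(\<Sum>s<L + g. card A) = (\<Sum>s<L + g. card (?B s)) + (\<Sum>s<L + g. card (?R s))"
    by (simp flip: sum.distrib)
  moreover have "(\<Sum>s<L + g. card (?B s)) = L * card A"
    using sum_shifts[of L "L + g" A "\<lambda>_. 1"] assms by (simp flip: of_nat_sum of_nat_mult)
  ultimately have "(\<Sum>s<L + g. card (?R s)) = g * card A" by (simp add: algebra_simps)
  moreover have "(\<Sum>s<L + g. g * card A) < (\<Sum>s<L + g. (L + g) * card (?R s))"
    using contra assms by (intro sum_strict_mono) (auto simp: not_le)
  ultimately show False by (simp flip: sum_distrib_left)
qed

context lacunary
begin

lemma exists_gap: "\<exists>g::nat. K \<le> q ^ g"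
  using real_arch_pow[OF q, of K] by (auto intro: less_imp_le)

lemma separated_shift:
  assumes A: "finite A" "A \<subseteq> {1..}" and g: "K \<le> q ^ g" and L: "0 < L"
  shows "separated L {k \<in> A. (k + s) mod (L + g) < L}"
  unfolding separated_def
proof (intro conjI exI[of _ "\<lambda>k. (k + s) div (L + g)"] ballI impI allI)
  let ?P = "L + g" and ?B = "{k \<in> A. (k + s) mod (L + g) < L}"
  show "finite ?B" "?B \<subseteq> {1..}" using A by auto
  fix k l assume kl: "k \<in> ?B" "l \<in> ?B" "(k + s) div ?P < (l + s) div ?P"
  have "k + s + g < (k + s) div ?P * ?P + ?P"
    using kl(1) div_mult_mod_eq[of "k + s" ?P] by (simp only: mem_Collect_eq) linarith
  also have "\<dots> = Suc ((k + s) div ?P) * ?P" by simp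
  also have "\<dots> \<le> (l + s) div ?P * ?P" using kl(3) by (intro mult_right_mono) auto
  also have "\<dots> \<le> l + s" by simp
  finally have lt: "k + g < l" by simp
  have "K * n k \<le> q ^ (l - k) * n k"
    using q lt by (intro mult_right_mono order_trans[OF g] power_increasing) auto
  also have "\<dots> \<le> n l" using growth[of k "l - k"] kl(1) A lt by auto
  finally show "K * n k \<le> n l" .
next
  fix j
  let ?P = "L + g" and ?C = "{k \<in> {k \<in> A. (k + s) mod (L + g) < L}. (k + s) div (L + g) = j}"
  have "inj_on (\<lambda>k. (k + s) mod ?P) ?C"
  proof (rule inj_onI)
    fix x y assume xy: "x \<in> ?C" "y \<in> ?C" "(x + s) mod ?P = (y + s) mod ?P"
    then have "x + s = y + s" by (metis (mono_tags, lifting) div_mult_mod_eq mem_Collect_eq)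
    then show "x = y" by simp
  qed
  then have "card ?C \<le> card {..<L}" by (rule card_inj_on_le) auto
  then show "card ?C \<le> L" by simp
qed

text \<open>Cutting out the gaps loses only a factor: \<open>S\<^sub>A\<close> is the average over all shifts of the
  rescaled sums over the separated parts, and \<open>exp\<close> is convex.\<close>
lemma exp_moment:
  fixes \<epsilon> :: real
  assumes "\<epsilon> > 0"
  shows "\<exists>u0>0. \<forall>A u. finite A \<and> A \<subseteq> {1..} \<and> \<bar>u\<bar> \<le> u0 \<longrightarrow>
    (LINT x|unit_interval_space. exp (block_sum (\<lambda>_. u) A x)) \<le> exp ((1 + \<epsilon>) * u\<^sup>2 * card A / 4)"
proof -
  obtain g where g: "K \<le> q ^ g" using exists_gap by blast
  have "((\<lambda>L::nat. ((L + g) / L)\<^sup>2) \<longlongrightarrow> 1) at_top" by real_asymp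
  then have "\<forall>\<^sub>F L::nat in at_top. ((L + g) / L)\<^sup>2 < 1 + \<epsilon> / 2"
    by (rule order_tendstoD) (use assms in simp)
  then have "\<forall>\<^sub>F L::nat in at_top. ((L + g) / L)\<^sup>2 < 1 + \<epsilon> / 2 \<and> L > 0"
    using eventually_gt_at_top by (rule eventually_conj)
  then obtain L :: nat where L: "((L + g) / L)\<^sup>2 < 1 + \<epsilon> / 2" "L > 0"
    using eventually_happens'[OF sequentially_bot] by blast
  define P where "P = L + g"
  define u0 where "u0 = min (1 / (2 * P)) (\<epsilon> / (8 * P ^ 3))"
  have P: "P > 0" "L \<le> P" using L by (auto simp: P_def)
  have "u0 > 0" using P assms by (simp add: u0_def)
  moreover have "(LINT x|unit_interval_space. exp (block_sum (\<lambda>_. u) A x)) \<le> exp ((1 + \<epsilon>) * u\<^sup>2 * card A / 4)"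
    if A: "finite A" "A \<subseteq> {1..}" and l: "\<bar>u\<bar> \<le> u0" for A u
  proof -
    let ?B = "\<lambda>s. {k \<in> A. (k + s) mod P < L}"
    define \<mu> where "\<mu> = P / L * u"
    have Pl: "P * \<bar>u\<bar> \<le> 1 / 2" and Pl3: "P ^ 3 * \<bar>u\<bar> \<le> \<epsilon> / 8"
    proof -
      have "\<bar>u\<bar> \<le> 1 / (2 * P)" "\<bar>u\<bar> \<le> \<epsilon> / (8 * P ^ 3)" using l by (auto simp: u0_def)
      then show "P * \<bar>u\<bar> \<le> 1 / 2" "P ^ 3 * \<bar>u\<bar> \<le> \<epsilon> / 8" using P by (auto simp: field_simps)
    qed
    have Lm: "L * \<bar>\<mu>\<bar> = P * \<bar>u\<bar>" using L by (simp add: \<mu>_def abs_mult)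
    have avg: "block_sum (\<lambda>_. u) A x = (\<Sum>s<P. (1 / P) *\<^sub>R block_sum (\<lambda>_. \<mu>) (?B s) x)" for x
    proof -
      have "(\<Sum>s<P. block_sum (\<lambda>_. \<mu>) (?B s) x) = L * block_sum (\<lambda>_. \<mu>) A x"
        unfolding block_sum_def by (rule sum_shifts[OF P(2) A(1)])
      also have "\<dots> = P * block_sum (\<lambda>_. u) A x"
        using L by (simp add: block_sum_def \<mu>_def sum_distrib_left mult.assoc)
      finally show ?thesis using P by (simp flip: sum_divide_distrib)
    qed
    have "exp (block_sum (\<lambda>_. u) A x) \<le> (\<Sum>s<P. (1 / P) * exp (block_sum (\<lambda>_. \<mu>) (?B s) x))" for x
      unfolding avg by (rule convex_on_sum[OF _ _ exp_convex]) (use P in auto)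
    then have "(LINT x|unit_interval_space. exp (block_sum (\<lambda>_. u) A x)) \<le>
       (LINT x|unit_interval_space. (\<Sum>s<P. (1 / P) * exp (block_sum (\<lambda>_. \<mu>) (?B s) x)))"
      by (intro integral_mono unit_interval_integrable continuous_intros)
    also have "\<dots> = (\<Sum>s<P. (1 / P) * (LINT x|unit_interval_space. exp (block_sum (\<lambda>_. \<mu>) (?B s) x)))"
      by (subst Bochner_Integration.integral_sum)
         (auto intro!: unit_interval_integrable continuous_intros)
    also have "\<dots> \<le> (\<Sum>s<P. (1 / P) * exp ((1 + \<epsilon>) * u\<^sup>2 * card A / 4))"
    proof (intro sum_mono mult_left_mono)
      fix s
      have "(LINT x|unit_interval_space. exp (block_sum (\<lambda>_. \<mu>) (?B s) x)) \<le>
        exp ((\<Sum>k\<in>?B s. \<mu>\<^sup>2) / 4 + real L ^ 3 * (\<Sum>k\<in>?B s. \<bar>\<mu>\<bar> ^ 3))"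
        unfolding P_def by (rule exp_moment_upper[OF separated_shift[OF A g L(2)]])
         (use Lm Pl in linarith)
      also have "(\<Sum>k\<in>?B s. \<mu>\<^sup>2) / 4 + real L ^ 3 * (\<Sum>k\<in>?B s. \<bar>\<mu>\<bar> ^ 3) = card (?B s) * (\<mu>\<^sup>2 / 4 + (L * \<bar>\<mu>\<bar>) ^ 3)"
        by (simp add: algebra_simps)
      also have "\<dots> \<le> card A * ((1 + \<epsilon>) * u\<^sup>2 / 4)"
      proof (rule mult_mono)
        show "real (card (?B s)) \<le> card A" using A by (auto intro: card_mono)
        have "\<mu>\<^sup>2 = ((L + g) / L)\<^sup>2 * u\<^sup>2" by (simp add: \<mu>_def P_def power_mult_distrib power_divide)
        also have "\<dots> \<le> (1 + \<epsilon> / 2) * u\<^sup>2" using L by (intro mult_right_mono) auto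
        finally have 1: "\<mu>\<^sup>2 \<le> (1 + \<epsilon> / 2) * u\<^sup>2" .
        have "(L * \<bar>\<mu>\<bar>) ^ 3 = (P ^ 3 * \<bar>u\<bar>) * u\<^sup>2"
          unfolding Lm by (simp add: power_mult_distrib eval_nat_numeral abs_mult_self_eq mult_ac)
        also have "\<dots> \<le> \<epsilon> / 8 * u\<^sup>2" using Pl3 by (intro mult_right_mono) auto
        finally show "\<mu>\<^sup>2 / 4 + (L * \<bar>\<mu>\<bar>) ^ 3 \<le> (1 + \<epsilon>) * u\<^sup>2 / 4"
          using 1 by (simp add: algebra_simps)
      qed auto
      finally show "(LINT x|unit_interval_space. exp (block_sum (\<lambda>_. \<mu>) (?B s) x)) \<le> exp ((1 + \<epsilon>) * u\<^sup>2 * card A / 4)"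
        by (simp add: mult_ac)
    qed auto
    also have "\<dots> = exp ((1 + \<epsilon>) * u\<^sup>2 * card A / 4)" using P by simp
    finally show ?thesis .
  qed
  ultimately show ?thesis by blast
qed

lemma chernoff:
  assumes "u > 0"
  shows "U.prob {x \<in> {0..1}. t \<le> block_sum c B x} \<le>
    exp (- u * t) * (LINT x|unit_interval_space. exp (block_sum (\<lambda>k. u * c k) B x))"
proof -
  have eq: "block_sum (\<lambda>k. u * c k) B x = u * block_sum c B x" for x
    by (simp add: block_sum_def sum_distrib_left mult_ac)
  have int: "integrable unit_interval_space (\<lambda>x. exp (u * block_sum c B x))"
    by (intro unit_interval_integrable continuous_intros)
  then have "set_integrable unit_interval_space {0..1} (\<lambda>x. exp (u * block_sum c B x))"
    using set_integrable_subset[of unit_interval_space UNIV] integrable_mult_indicator[OF sets.top int]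
    by (simp add: set_integrable_def)
  from U.Chernoff_ineq_ge[OF assms this] sets.top[of unit_interval_space]
    set_integral_space[OF int]
  show ?thesis by (simp add: eq)
qed

definition unweighted :: "nat set \<Rightarrow> real \<Rightarrow> real" where
  "unweighted = block_sum (\<lambda>_. 1)"

lemma unweighted_tail:
  fixes \<epsilon> :: real
  assumes "\<epsilon> > 0"
  shows "\<exists>u0>0. \<forall>A u t. finite A \<and> A \<subseteq> {1..} \<and> 0 < u \<and> u \<le> u0 \<longrightarrow>
    U.prob {x \<in> {0..1}. t \<le> \<bar>unweighted A x\<bar>} \<le> 2 * exp ((1 + \<epsilon>) * u\<^sup>2 * card A / 4 - u * t)"
proof -
  obtain u0 where l0: "u0 > 0"
    "\<And>A u. finite A \<Longrightarrow> A \<subseteq> {1..} \<Longrightarrow> \<bar>u\<bar> \<le> u0 \<Longrightarrow>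
      (LINT x|unit_interval_space. exp (block_sum (\<lambda>_. u) A x)) \<le> exp ((1 + \<epsilon>) * u\<^sup>2 * card A / 4)"
    using exp_moment[OF assms] by blast
  have "U.prob {x \<in> {0..1}. t \<le> \<bar>unweighted A x\<bar>} \<le> 2 * exp ((1 + \<epsilon>) * u\<^sup>2 * card A / 4 - u * t)"
    if A: "finite A" "A \<subseteq> {1..}" "0 < u" "u \<le> u0" for A u t
  proof -
    have sets: "{x \<in> {0..1}. t \<le> block_sum c A x} \<in> U.events" for c
      using measurable_sets[OF unit_interval_measurable[OF block_sum_measurable[of c A]], of "{t..}"]
      by (simp add: vimage_def Int_def conj_commute)
    have one: "U.prob {x \<in> {0..1}. t \<le> block_sum (\<lambda>_. \<delta>) A x} \<le> exp ((1 + \<epsilon>) * u\<^sup>2 * card A / 4 - u * t)"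
      if d: "\<bar>\<delta>\<bar> = 1" for \<delta> :: real
    proof -
      have d2: "\<delta>\<^sup>2 = 1" using d by (metis power2_abs power_one)
      have "U.prob {x \<in> {0..1}. t \<le> block_sum (\<lambda>_. \<delta>) A x} \<le>
        exp (- u * t) * (LINT x|unit_interval_space. exp (block_sum (\<lambda>k. u * \<delta>) A x))"
        by (rule chernoff[OF A(3)])
      also have "\<dots> \<le> exp (- u * t) * exp ((1 + \<epsilon>) * (u * \<delta>)\<^sup>2 * card A / 4)"
        using A d by (intro mult_left_mono l0(2)) (auto simp: abs_mult)
      finally show ?thesis using d2 by (simp add: power_mult_distrib flip: exp_add)
    qed
    have "{x \<in> {0..1}. t \<le> \<bar>unweighted A x\<bar>} =
      {x \<in> {0..1}. t \<le> block_sum (\<lambda>_. 1) A x} \<union> {x \<in> {0..1}. t \<le> block_sum (\<lambda>_. - 1) A x}"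
      by (auto simp: unweighted_def block_sum_def sum_negf)
    then have "U.prob {x \<in> {0..1}. t \<le> \<bar>unweighted A x\<bar>} \<le>
      U.prob {x \<in> {0..1}. t \<le> block_sum (\<lambda>_. 1) A x} + U.prob {x \<in> {0..1}. t \<le> block_sum (\<lambda>_. - 1) A x}"
      using measure_Un_le[OF sets[of "\<lambda>_. 1"] sets[of "\<lambda>_. - 1"]] by simp
    also have "\<dots> \<le> 2 * exp ((1 + \<epsilon>) * u\<^sup>2 * card A / 4 - u * t)"
      using one[of 1] one[of "- 1"] by simp
    finally show ?thesis .
  qed
  then show ?thesis using l0(1) by blast
qed

end

section \<open>Dyadic chaining\<close>

lemma AE_eventually_notin:
  assumes A: "\<And>k. A k \<in> U.events" and le: "\<forall>\<^sub>F k in sequentially. U.prob (A k) \<le> f k"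
    and f: "summable (f :: nat \<Rightarrow> real)"
  shows "AE x in unit_interval_space. \<forall>\<^sub>F k in sequentially. x \<notin> A k"
proof -
  have "\<forall>\<^sub>F k in sequentially. norm (U.prob (A k)) \<le> f k" using le by simp
  then have "summable (\<lambda>k. U.prob (A k))" by (rule summable_comparison_test_ev) (rule f)
  then have "AE x in unit_interval_space. \<forall>\<^sub>F k in sequentially. x \<in> space unit_interval_space - A k"
    by (intro borel_cantelli_AE1 A) (auto simp: U.emeasure_eq_measure)
  then show ?thesis
    by (rule eventually_mono) (erule eventually_mono, blast)
qed

lemma prob_finite_union_le:
  assumes "finite I" "\<And>i. i \<in> I \<Longrightarrow> A i \<in> U.events" "\<And>i. i \<in> I \<Longrightarrow> U.prob (A i) \<le> f i"
  shows "U.prob (\<Union>i\<in>I. A i) \<le> sum f I"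
proof -
  have "U.prob (\<Union>i\<in>I. A i) \<le> (\<Sum>i\<in>I. U.prob (A i))"
    by (rule measure_UNION_le) (use assms in blast)+
  also have "\<dots> \<le> sum f I" by (rule sum_mono) (rule assms(3))
  finally show ?thesis .
qed

locale permuted_lacunary = lacunary +
  fixes \<sigma> :: "nat \<Rightarrow> nat"
  assumes perm: "bij_betw \<sigma> {1..} {1..}"
begin

definition S :: "nat \<Rightarrow> real \<Rightarrow> real" where
  "S N x = (\<Sum>k=1..N. cos (2 * pi * real (n (\<sigma> k)) * x))"

lemma S_continuous [continuous_intros]: "continuous_on A (S N)"
  unfolding S_def by (intro continuous_intros)

lemma S_measurable [measurable]: "S N \<in> borel_measurable borel"
  by (intro borel_measurable_continuous_onI S_continuous)

lemma inj_sigma: "A \<subseteq> {1..} \<Longrightarrow> inj_on \<sigma> A"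
  by (rule inj_on_subset[OF bij_betw_imp_inj_on[OF perm]])

lemma sigma_image: "\<sigma> ` {a<..b} \<subseteq> {1..}"
proof -
  have "\<sigma> ` {a<..b} \<subseteq> \<sigma> ` {1..}" by (rule image_mono) auto
  then show ?thesis by (simp only: bij_betw_imp_surj_on[OF perm])
qed

lemma card_sigma_image: "card (\<sigma> ` {a<..b}) = b - a"
  using card_image[OF inj_sigma, of "{a<..b}"] by force

lemma S_diff:
  assumes "a \<le> b"
  shows "S b x - S a x = unweighted (\<sigma> ` {a<..b}) x"
proof -
  have eq: "{1..b} = {1..a} \<union> {a<..b}" using assms by auto
  have "S b x = S a x + (\<Sum>k\<in>{a<..b}. cos (2 * pi * real (n (\<sigma> k)) * x))"
    unfolding S_def eq by (rule sum.union_disjoint) auto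
  moreover have "inj_on \<sigma> {a<..b}" by (rule inj_sigma) (simp add: subset_eq)
  ultimately show ?thesis
    by (simp add: unweighted_def block_sum_def sum.reindex)
qed

lemma S_lipschitz:
  assumes "a \<le> b"
  shows "\<bar>S b x - S a x\<bar> \<le> real (b - a)"
proof -
  have "\<bar>S b x - S a x\<bar> \<le> (\<Sum>k\<in>\<sigma> ` {a<..b}. \<bar>1 * cos (2 * pi * real (n k) * x)\<bar>)"
    unfolding S_diff[OF assms] unweighted_def block_sum_def by (rule sum_abs)
  also have "\<dots> \<le> (\<Sum>k\<in>\<sigma> ` {a<..b}. 1)" by (intro sum_mono) simp
  finally show ?thesis by (simp add: card_sigma_image)
qed

lemma S_tail:
  fixes \<epsilon> :: real
  assumes "\<epsilon> > 0"
  shows "\<exists>u0>0. \<forall>a b u t. a \<le> b \<and> 0 < u \<and> u \<le> u0 \<longrightarrow>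
    U.prob {x \<in> {0..1}. t \<le> \<bar>S b x - S a x\<bar>} \<le> 2 * exp ((1 + \<epsilon>) * u\<^sup>2 * real (b - a) / 4 - u * t)"
proof -
  from unweighted_tail[OF assms] obtain u0 where u0: "u0 > 0" "\<forall>A u t. finite A \<and> A \<subseteq> {1..} \<and> 0 < u \<and> u \<le> u0 \<longrightarrow>
      U.prob {x \<in> {0..1}. t \<le> \<bar>unweighted A x\<bar>} \<le> 2 * exp ((1 + \<epsilon>) * u\<^sup>2 * card A / 4 - u * t)"
    by (elim exE conjE)
  show ?thesis
  proof (intro exI[of _ u0] conjI allI impI u0(1))
    fix a b :: nat and u t :: real assume *: "a \<le> b \<and> 0 < u \<and> u \<le> u0"
    have "finite (\<sigma> ` {a<..b}) \<and> \<sigma> ` {a<..b} \<subseteq> {1..} \<and> 0 < u \<and> u \<le> u0"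
      using * sigma_image by simp
    from u0(2)[rule_format, OF this, of t]
    show "U.prob {x \<in> {0..1}. t \<le> \<bar>S b x - S a x\<bar>} \<le> 2 * exp ((1 + \<epsilon>) * u\<^sup>2 * real (b - a) / 4 - u * t)"
      unfolding S_diff[OF conjunct1[OF *]] card_sigma_image .
  qed
qed

lemma S_events [measurable]: "{x \<in> {0..1}. t \<le> \<bar>S b x - S a x\<bar>} \<in> U.events"
proof -
  have "(\<lambda>x. \<bar>S b x - S a x\<bar>) \<in> borel_measurable unit_interval_space"
    by (rule unit_interval_measurable) measurable
  from measurable_sets[OF this, of "{t..}"] show ?thesis
    by (simp add: vimage_def Int_def conj_commute)
qed

lemma dyadic_increments:
  "AE x in unit_interval_space. \<forall>\<^sub>F k in sequentially. \<forall>i a. i \<le> k \<and> k \<le> 2 * i \<and> a < 2 ^ (k + 1 - i) \<longrightarrow>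
     \<bar>S (Suc a * 2 ^ i) x - S (a * 2 ^ i) x\<bar> \<le> 4 * (4 / 5) ^ (k - i) * sqrt (2 ^ k * ln k)"
proof -
  let ?t = "\<lambda>k i. 4 * (4 / 5) ^ (k - i) * sqrt (2 ^ k * ln (real k))"
  let ?A = "\<lambda>k (i, a). {x \<in> {0..1}. ?t k i \<le> \<bar>S (Suc a * 2 ^ i) x - S (a * 2 ^ i) x\<bar>}"
  define I :: "nat \<Rightarrow> (nat \<times> nat) set"
    where "I k = (SIGMA i:{i. i \<le> k \<and> k \<le> 2 * i}. {..<2 ^ (k + 1 - i)})" for k
  obtain u0 where u0: "u0 > 0" "\<And>a b u t. a \<le> b \<Longrightarrow> 0 < u \<Longrightarrow> u \<le> u0 \<Longrightarrow>
    U.prob {x \<in> {0..1}. t \<le> \<bar>S b x - S a x\<bar>} \<le> 2 * exp ((1 + 1) * u\<^sup>2 * real (b - a) / 4 - u * t)"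
    using S_tail[of 1] by (auto simp del: one_add_one)
  have finI: "finite (I k)" for k unfolding I_def by (intro finite_SigmaI) auto
  have evA: "?A k p \<in> U.events" for k p
    by (cases p) (simp only: prod.case S_events)
  have ev: "(\<Union>p\<in>I k. ?A k p) \<in> U.events" for k
    by (intro sets.finite_UN finI evA)
  have "(\<lambda>k. 16 * (4 / 5) ^ k * ln (real k)) \<longlonglongrightarrow> 0" by real_asymp
  then have "\<forall>\<^sub>F k in sequentially. 16 * (4 / 5) ^ k * ln (real k) < u0\<^sup>2"
    by (rule order_tendstoD) (use u0 in simp)
  then have "\<forall>\<^sub>F k in sequentially. U.prob (\<Union>p\<in>I k. ?A k p) \<le> 8 / real k ^ 2"
    using eventually_ge_at_top[of 3]
  proof eventually_elim
    case (elim k)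
    have lnk: "ln (real k) > 0" "exp (- ln (real k)) = 1 / real k"
      using elim by (auto simp: exp_minus inverse_eq_divide)
    have "U.prob (?A k (i, a)) \<le> 2 / (real k ^ 8 * 2 ^ (k - i))" if ia: "(i, a) \<in> I k" for i a
    proof -
      define r where "r = k - i"
      have r: "i = k - r" "r \<le> k" "2 * r \<le> k" using ia by (auto simp: I_def r_def)
      define v where "v = sqrt (2 ^ k * ln (real k))"
      have v: "v > 0" "v\<^sup>2 = 2 ^ k * ln (real k)" using lnk by (auto simp: v_def)
      define E :: real where "E = 2 ^ k"
      define w :: real where "w = (8 / 5) ^ r"
      define u where "u = 4 * w * v / E"
      have E: "E > 0" "v\<^sup>2 = E * ln (real k)" by (simp_all add: E_def v)
      have two: "(2::real) ^ i = E / 2 ^ r" using r by (simp add: power_diff E_def)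
      have usq: "u\<^sup>2 = 16 * w\<^sup>2 * ln (real k) / E"
        using E by (simp add: u_def power_mult_distrib power_divide) (simp add: power2_eq_square)
      also have "\<dots> = 16 * (8 / 5) ^ (2 * r) * ln (real k) / E"
        by (simp add: w_def power_mult[symmetric] mult.commute)
      also have "\<dots> \<le> 16 * (8 / 5) ^ k * ln (real k) / E"
        using r lnk E by (intro divide_right_mono mult_right_mono mult_left_mono power_increasing) auto
      also have "\<dots> = 16 * (4 / 5) ^ k * ln (real k)"
        using power_divide[of "8 / 5 :: real" 2 k] by (simp add: E_def)
      also have "\<dots> < u0\<^sup>2" by (rule elim)
      finally have ule: "u \<le> u0" using u0 by (intro power2_le_imp_le[of u u0]) auto
      have upos: "u > 0" using v E by (simp add: u_def w_def)
      have "U.prob (?A k (i, a)) \<le> 2 * exp ((1 + 1) * u\<^sup>2 * real (Suc a * 2 ^ i - a * 2 ^ i) / 4 - u * ?t k i)"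
        unfolding prod.case by (rule u0(2)[OF _ upos ule]) simp
      also have "real (Suc a * 2 ^ i - a * 2 ^ i) = E / 2 ^ r" using two by simp
      also have "(1 + 1) * u\<^sup>2 * (E / 2 ^ r) / 4 - u * ?t k i = - 8 * (32 / 25) ^ r * ln (real k)"
      proof -
        have "(8 / 5 :: real) ^ r = (4 / 5) ^ r * 2 ^ r" by (simp flip: power_mult_distrib)
        then have t: "?t k i = u * (E / 2 ^ r)"
          using E unfolding u_def v_def[symmetric] r_def[symmetric] w_def by simp
        have "(1 + 1) * u\<^sup>2 * (E / 2 ^ r) / 4 - u * ?t k i = - (u\<^sup>2 * (E / 2 ^ r) / 2)"
          unfolding t by (simp add: power2_eq_square algebra_simps)
        also have "\<dots> = - 8 * (w\<^sup>2 / 2 ^ r) * ln (real k)"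
          using E by (simp add: usq)
        also have "w\<^sup>2 / 2 ^ r = (32 / 25) ^ r"
          unfolding w_def power2_eq_square by (simp flip: power_mult_distrib power_divide)
        finally show ?thesis .
      qed
      also have "exp (- 8 * (32 / 25) ^ r * ln (real k)) \<le> exp (real (8 + 2 * r) * - ln (real k))"
      proof -
        have "1 + real r * (7 / 25) \<le> (1 + 7 / 25 :: real) ^ r" by (rule Bernoulli_inequality) simp
        then have "real (8 + 2 * r) \<le> 8 * (32 / 25) ^ r" by simp
        from mult_right_mono[OF this, of "ln (real k)"] lnk show ?thesis by simp
      qed
      also have "\<dots> = (1 / real k) ^ (8 + 2 * r)" by (simp only: exp_of_nat_mult lnk)
      also have "\<dots> \<le> 1 / (real k ^ 8 * 2 ^ r)"
      proof -
        have "2 ^ r \<le> real k ^ r" using elim by (intro power_mono) auto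
        also have "\<dots> \<le> real k ^ (2 * r)" using elim by (intro power_increasing) auto
        finally show ?thesis using elim by (simp add: power_one_over power_add divide_simps)
      qed
      finally show ?thesis by (simp add: r_def)
    qed
    then have "U.prob (\<Union>p\<in>I k. ?A k p) \<le> (\<Sum>(i, a)\<in>I k. 2 / (real k ^ 8 * 2 ^ (k - i)))"
      by (intro prob_finite_union_le finI evA) auto
    also have "\<dots> = (\<Sum>i\<in>{i. i \<le> k \<and> k \<le> 2 * i}. 4 / real k ^ 8)"
      unfolding I_def by (subst sum.Sigma[symmetric]) (auto intro!: sum.cong simp: Suc_diff_le)
    also have "\<dots> \<le> (\<Sum>i\<in>{..k}. 4 / real k ^ 8)" by (rule sum_mono2) auto
    also have "\<dots> \<le> 8 / real k ^ 7" using elim by (simp add: field_simps eval_nat_numeral)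
    also have "\<dots> \<le> 8 / real k ^ 2"
      using elim by (intro divide_left_mono power_increasing) auto
    finally show ?case .
  qed
  moreover have "summable (\<lambda>k. 8 / real k ^ 2)"
    using summable_mult[OF inverse_power_summable[of 2, where 'a = real], of 8] by (simp add: field_simps)
  ultimately have "AE x in unit_interval_space. \<forall>\<^sub>F k in sequentially. x \<notin> (\<Union>p\<in>I k. ?A k p)"
    by (intro AE_eventually_notin ev)
  moreover have "AE x in unit_interval_space. x \<in> {0..1}"
    using AE_space[of unit_interval_space] by simp
  ultimately show ?thesis
  proof eventually_elim
    case (elim x)
    from elim(1) show ?case
    proof eventually_elim
      case (elim k)
      show ?case
      proof (intro allI impI)
        fix i a :: nat assume "i \<le> k \<and> k \<le> 2 * i \<and> a < 2 ^ (k + 1 - i)"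
        then have "(i, a) \<in> I k" by (auto simp: I_def)
        then have "x \<notin> ?A k (i, a)" using elim by blast
        then show "\<bar>S (Suc a * 2 ^ i) x - S (a * 2 ^ i) x\<bar> \<le> ?t k i"
          using \<open>x \<in> {0..1}\<close> unfolding prod.case mem_Collect_eq by linarith
      qed
    qed
  qed
qed

lemma dyadic_chain:
  assumes inc: "\<And>i a. i \<le> k \<Longrightarrow> k \<le> 2 * i \<Longrightarrow> a < 2 ^ (k + 1 - i) \<Longrightarrow>
     \<bar>S (Suc a * 2 ^ i) x - S (a * 2 ^ i) x\<bar> \<le> 4 * (4 / 5) ^ (k - i) * v"
    and v: "v \<ge> 0" and N: "2 ^ k \<le> N" "N < 2 ^ (k + 1)" and R: "2 * R \<le> k"
  shows "\<bar>S N x - S (N div 2 ^ (k - R) * 2 ^ (k - R)) x\<bar> \<le> 20 * (4 / 5) ^ R * v + 2 * sqrt (2 ^ k)"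
proof -
  let ?N = "\<lambda>r. N div 2 ^ (k - r) * 2 ^ (k - r)"
  have chain: "\<bar>S (?N r) x - S (?N R) x\<bar> \<le> 20 * ((4 / 5) ^ R - (4 / 5) ^ r) * v" if "R \<le> r" "2 * r \<le> k" for r
    using that
  proof (induction r rule: dec_induct)
    case (step r)
    define i where "i = k - Suc r"
    have i: "k - r = Suc i" "i \<le> k" "k \<le> 2 * i" "k - i = Suc r" using step.prems by (auto simp: i_def)
    define a where "a = 2 * (N div 2 ^ Suc i)"
    have ai: "a * 2 ^ i = N div 2 ^ Suc i * 2 ^ Suc i" by (simp add: a_def)
    have Ni: "N div 2 ^ i < 2 ^ (k + 1 - i)"
      using N i by (intro less_mult_imp_div_less) (simp flip: power_add)
    have dd: "N div 2 ^ Suc i = N div 2 ^ i div 2" by (simp only: power_Suc2 div_mult2_eq)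
    have "N div 2 ^ i = a \<or> N div 2 ^ i = Suc a" unfolding a_def dd by linarith
    then have "\<bar>S (N div 2 ^ i * 2 ^ i) x - S (a * 2 ^ i) x\<bar> \<le> 4 * (4 / 5) ^ Suc r * v"
    proof
      assume Suc: "N div 2 ^ i = Suc a"
      then have "a < 2 ^ (k + 1 - i)" using Ni by linarith
      from inc[OF i(2,3) this] show ?thesis unfolding Suc i(4) .
    qed (use v in simp)
    then have "\<bar>S (?N (Suc r)) x - S (?N r) x\<bar> \<le> 4 * (4 / 5) ^ Suc r * v"
      unfolding i(1) i_def[symmetric] ai .
    moreover have "\<bar>S (?N r) x - S (?N R) x\<bar> \<le> 20 * ((4 / 5) ^ R - (4 / 5) ^ r) * v"
      using step by auto
    moreover have "4 * (4 / 5) ^ Suc r * v + 20 * ((4 / 5) ^ R - (4 / 5) ^ r) * v \<le> 20 * ((4 / 5) ^ R - (4 / 5) ^ Suc r) * v"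
      using v by (simp add: algebra_simps)
    ultimately show ?case by linarith
  qed simp
  define r where "r = k div 2"
  have r: "R \<le> r" "2 * r \<le> k" "k \<le> 2 * r + 1" using R by (auto simp: r_def)
  have "\<bar>S N x - S (?N r) x\<bar> \<le> real (N - ?N r)" by (rule S_lipschitz) simp
  also have "real (N - ?N r) \<le> 2 ^ (k - r)"
    by (simp add: minus_div_mult_eq_mod less_imp_le flip: of_nat_power[of 2, simplified])
  also have "(2::real) ^ (k - r) \<le> sqrt (2 ^ (k + 1))"
  proof (rule real_le_rsqrt)
    have "((2::real) ^ (k - r))\<^sup>2 = 2 ^ ((k - r) * 2)" by (rule power_mult[symmetric])
    also have "\<dots> \<le> 2 ^ (k + 1)" using r by (intro power_increasing) auto
    finally show "((2::real) ^ (k - r))\<^sup>2 \<le> 2 ^ (k + 1)" .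
  qed
  also have "\<dots> \<le> 2 * sqrt (2 ^ k)" by (rule real_le_lsqrt) (auto simp: power_mult_distrib)
  finally have 1: "\<bar>S N x - S (?N r) x\<bar> \<le> 2 * sqrt (2 ^ k)" .
  have "20 * ((4 / 5) ^ R - (4 / 5) ^ r) * v \<le> 20 * (4 / 5) ^ R * v"
    using v by (intro mult_right_mono) auto
  with 1 chain[OF r(1,2)] show ?thesis by linarith
qed

end

section \<open>Upper bound in the law of the iterated logarithm\<close>

context permuted_lacunary
begin

lemma grid_bound:
  fixes \<delta> :: real
  assumes "\<delta> > 0"
  shows "AE x in unit_interval_space. \<forall>\<^sub>F k in sequentially. \<forall>a. 1 \<le> a \<and> a < 2 ^ (R + 1) \<longrightarrow>
     \<bar>S (a * 2 ^ (k - R)) x\<bar> \<le> (1 + \<delta>) * sqrt (real (a * 2 ^ (k - R)) * ln k)"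
proof -
  let ?t = "\<lambda>k a. (1 + \<delta>) * sqrt (real (a * 2 ^ (k - R)) * ln (real k))"
  let ?A = "\<lambda>k a. {x \<in> {0..1}. ?t k a \<le> \<bar>S (a * 2 ^ (k - R)) x - S 0 x\<bar>}"
  let ?I = "{1..<2 ^ (R + 1)} :: nat set"
  from S_tail[OF assms] obtain u0 where u0: "u0 > 0" "\<forall>a b u t. a \<le> b \<and> 0 < u \<and> u \<le> u0 \<longrightarrow>
    U.prob {x \<in> {0..1}. t \<le> \<bar>S b x - S a x\<bar>} \<le> 2 * exp ((1 + \<delta>) * u\<^sup>2 * real (b - a) / 4 - u * t)"
    by (elim exE conjE)
  have ev: "(\<Union>a\<in>?I. ?A k a) \<in> U.events" for k
    by (intro sets.finite_UN S_events) simp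
  have "(\<lambda>k. 4 * 2 ^ R * ln (real k) / 2 ^ k) \<longlonglongrightarrow> 0" by real_asymp
  then have "\<forall>\<^sub>F k in sequentially. 4 * 2 ^ R * ln (real k) / 2 ^ k < u0\<^sup>2"
    by (rule order_tendstoD) (use u0 in simp)
  then have "\<forall>\<^sub>F k in sequentially. U.prob (\<Union>a\<in>?I. ?A k a) \<le> 2 ^ (R + 2) * real k powr - (1 + \<delta>)"
    using eventually_ge_at_top[of "max 3 R"]
  proof eventually_elim
    case (elim k)
    have k: "k \<ge> 3" "R \<le> k" using elim by auto
    have lnk: "ln (real k) > 0" using k by simp
    have "U.prob (?A k a) \<le> 2 * real k powr - (1 + \<delta>)" if a: "a \<in> ?I" for a
    proof -
      define N where "N = real (a * 2 ^ (k - R))"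
      have "2 ^ k / 2 ^ R = (2::real) ^ (k - R)" using k by (simp add: power_diff)
      also have "\<dots> \<le> N" using a mult_right_mono[of 1 "real a" "2 ^ (k - R)"] by (simp add: N_def)
      finally have N: "2 ^ k / 2 ^ R \<le> N" .
      have Npos: "N > 0" using a by (simp add: N_def)
      define u where "u = 2 * sqrt (ln (real k) / N)"
      have u: "u > 0" using lnk Npos by (simp add: u_def)
      have usq: "u\<^sup>2 = 4 * ln (real k) / N" using lnk Npos by (simp add: u_def power_mult_distrib)
      have "u\<^sup>2 \<le> 4 * ln (real k) / (2 ^ k / 2 ^ R)"
        unfolding usq using N lnk Npos by (intro divide_left_mono mult_pos_pos) auto
      also have "\<dots> = 4 * 2 ^ R * ln (real k) / 2 ^ k" by simp
      also have "\<dots> < u0\<^sup>2" by (rule elim)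
      finally have ule: "u \<le> u0" using u0 by (intro power2_le_imp_le[of u u0]) auto
      have ut: "u * ?t k a = 2 * (1 + \<delta>) * ln (real k)"
      proof -
        have "sqrt (ln (real k) / N) * sqrt (N * ln (real k)) = ln (real k)"
          using lnk Npos by (simp flip: real_sqrt_mult)
        then show ?thesis unfolding u_def N_def[symmetric] by (simp add: algebra_simps)
      qed
      have "U.prob (?A k a) \<le> 2 * exp ((1 + \<delta>) * u\<^sup>2 * real (a * 2 ^ (k - R) - 0) / 4 - u * ?t k a)"
        by (rule u0(2)[rule_format]) (use u ule in simp)
      also have "(1 + \<delta>) * u\<^sup>2 * real (a * 2 ^ (k - R) - 0) / 4 - u * ?t k a = - (1 + \<delta>) * ln (real k)"
        unfolding ut unfolding diff_zero N_def[symmetric] usq using Npos by (simp add: field_simps)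
      also have "exp (- (1 + \<delta>) * ln (real k)) = real k powr - (1 + \<delta>)" using k by (simp add: powr_def)
      finally show ?thesis .
    qed
    then have "U.prob (\<Union>a\<in>?I. ?A k a) \<le> (\<Sum>a\<in>?I. 2 * real k powr - (1 + \<delta>))"
      by (intro prob_finite_union_le S_events) auto
    also have "\<dots> \<le> (\<Sum>a<2 ^ (R + 1) :: nat. 2 * real k powr - (1 + \<delta>))" by (rule sum_mono2) auto
    also have "\<dots> = 2 ^ (R + 2) * real k powr - (1 + \<delta>)" by simp
    finally show ?case .
  qed
  moreover have "summable (\<lambda>k. 2 ^ (R + 2) * real k powr - (1 + \<delta>))"
    using assms by (intro summable_mult) (simp add: summable_real_powr_iff)
  ultimately have "AE x in unit_interval_space. \<forall>\<^sub>F k in sequentially. x \<notin> (\<Union>a\<in>?I. ?A k a)"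
    by (intro AE_eventually_notin ev)
  moreover have "AE x in unit_interval_space. x \<in> {0..1}"
    using AE_space[of unit_interval_space] by simp
  ultimately show ?thesis
  proof eventually_elim
    case (elim x)
    from elim(1) show ?case
    proof eventually_elim
      case (elim k)
      show ?case
      proof (intro allI impI)
        fix a :: nat assume "1 \<le> a \<and> a < 2 ^ (R + 1)"
        then have "x \<notin> ?A k a" using elim by simp
        then show "\<bar>S (a * 2 ^ (k - R)) x\<bar> \<le> ?t k a"
          using \<open>x \<in> {0..1}\<close> unfolding mem_Collect_eq by (simp add: S_def)
      qed
    qed
  qed
qed

lemma lil_upper:
  fixes \<delta> :: real
  assumes "\<delta> > 0"
  shows "AE x in unit_interval_space. \<forall>\<^sub>F N in sequentially. \<bar>S N x\<bar> \<le> (1 + \<delta>) * sqrt (real N * ln (ln (real N)))"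
proof -
  define d where "d = min 1 (\<delta> / 7)"
  have d: "d > 0" "d \<le> 1" "7 * d \<le> \<delta>" using assms by (auto simp: d_def)
  have "(\<lambda>R. 20 * (4 / 5) ^ R :: real) \<longlonglongrightarrow> 0" by real_asymp
  then have "\<forall>\<^sub>F R in sequentially. 20 * (4 / 5) ^ R < d" by (rule order_tendstoD) (rule d(1))
  then obtain R where R: "20 * (4 / 5) ^ R < d" using eventually_happens'[OF sequentially_bot] by blast
  have "(\<lambda>k. 2 / sqrt (ln (real k))) \<longlonglongrightarrow> 0" by real_asymp
  then have 1: "\<forall>\<^sub>F k in sequentially. 2 / sqrt (ln (real k)) < d" by (rule order_tendstoD) (rule d(1))
  have "(\<lambda>k. ln (real k) / ln (real k * ln 2)) \<longlonglongrightarrow> 1" by real_asymp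
  then have 2: "\<forall>\<^sub>F k in sequentially. ln (real k) / ln (real k * ln 2) < (1 + d)\<^sup>2"
    by (rule order_tendstoD) (use d in simp)
  have 3: "\<forall>\<^sub>F k in sequentially. ln (real k * ln 2) > 0" by real_asymp
  from dyadic_increments grid_bound[OF d(1), of R]
  show ?thesis
  proof eventually_elim
    case (elim x)
    from elim 1 2 3 eventually_ge_at_top[of "max 3 (2 * R)"]
    have "\<forall>\<^sub>F k in sequentially. \<forall>N. 2 ^ k \<le> N \<and> N < 2 ^ (k + 1) \<longrightarrow> \<bar>S N x\<bar> \<le> (1 + \<delta>) * sqrt (real N * ln (ln (real N)))"
    proof eventually_elim
      case (elim k)
      have k: "k \<ge> 3" "2 * R \<le> k" using elim by auto
      have lnk: "ln (real k) > 0" using k by simp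
      show ?case
      proof (intro allI impI)
        fix N :: nat assume N: "2 ^ k \<le> N \<and> N < 2 ^ (k + 1)"
        define v where "v = sqrt (2 ^ k * ln (real k))"
        define w where "w = sqrt (real N * ln (real k))"
        let ?a = "N div 2 ^ (k - R)"
        have NR: "2 ^ k \<le> real N" using N by (metis of_nat_le_iff of_nat_numeral of_nat_power)
        have vw: "v \<le> w" unfolding v_def w_def using NR lnk by simp
        have a: "1 \<le> ?a \<and> ?a < 2 ^ (R + 1)"
        proof
          have "2 ^ (k - R) \<le> N" using N power_increasing[of "k - R" k "2::nat"] by linarith
          then show "1 \<le> ?a" by (simp add: Suc_le_eq div_greater_zero_iff)
          have "(2::nat) ^ (k + 1) = 2 ^ (R + 1) * 2 ^ (k - R)" using k by (simp flip: power_add)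
          then show "?a < 2 ^ (R + 1)" using N by (intro less_mult_imp_div_less) simp
        qed
        have "\<bar>S N x - S (?a * 2 ^ (k - R)) x\<bar> \<le> 20 * (4 / 5) ^ R * v + 2 * sqrt (2 ^ k)"
          by (rule dyadic_chain) (use elim(1) N k lnk in \<open>auto simp: v_def\<close>)
        moreover have "\<bar>S (?a * 2 ^ (k - R)) x\<bar> \<le> (1 + d) * w"
        proof -
          have "real (?a * 2 ^ (k - R)) \<le> real N" by (simp only: of_nat_le_iff) simp
          then have "(1 + d) * sqrt (real (?a * 2 ^ (k - R)) * ln k) \<le> (1 + d) * w"
            unfolding w_def using d lnk by (intro mult_left_mono real_sqrt_le_mono mult_right_mono) auto
          with elim(2)[rule_format, OF a] show ?thesis by (rule order_trans)
        qed
        moreover have "20 * (4 / 5) ^ R * v \<le> d * w"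
          using R vw d lnk by (intro mult_mono) (auto simp: v_def)
        moreover have "2 * sqrt (2 ^ k) \<le> d * w"
        proof -
          have "2 * sqrt (2 ^ k) = 2 / sqrt (ln k) * v" using lnk by (simp add: v_def real_sqrt_mult)
          also have "\<dots> \<le> d * w" using elim(3) vw d lnk by (intro mult_mono) (auto simp: v_def)
          finally show ?thesis .
        qed
        ultimately have Sw: "\<bar>S N x\<bar> \<le> (1 + 3 * d) * w" by (simp add: algebra_simps abs_le_iff)
        have "ln (real k) \<le> (1 + d)\<^sup>2 * ln (real k * ln 2)" using elim(4,5) by (simp add: field_simps)
        also have "ln (real k * ln 2) \<le> ln (ln (real N))"
        proof -
          have "real k * ln 2 = ln (2 ^ k)" by (simp add: ln_realpow)
          also have "\<dots> \<le> ln (real N)" using NR by (intro ln_mono) auto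
          finally show ?thesis using k by (intro ln_mono) auto
        qed
        finally have "ln (real k) \<le> (1 + d)\<^sup>2 * ln (ln (real N))" using d by (simp add: mult_left_mono)
        then have "w \<le> sqrt ((1 + d)\<^sup>2 * (real N * ln (ln (real N))))"
          unfolding w_def using mult_left_mono[of "ln (real k)" "(1 + d)\<^sup>2 * ln (ln (real N))" "real N"]
          by (simp add: mult_ac)
        also have "\<dots> = (1 + d) * sqrt (real N * ln (ln (real N)))" using d by (simp add: real_sqrt_mult)
        finally have wl: "w \<le> (1 + d) * sqrt (real N * ln (ln (real N)))" .
        have s0: "sqrt (real N * ln (ln (real N))) \<ge> 0"
        proof -
          have "w \<ge> 0" using lnk by (simp add: w_def)
          then have "0 \<le> (1 + d) * sqrt (real N * ln (ln (real N)))" using wl by linarith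
          then show ?thesis using d by (simp add: zero_le_mult_iff)
        qed
        have "(1 + 3 * d) * w \<le> (1 + 3 * d) * ((1 + d) * sqrt (real N * ln (ln (real N))))"
          using wl d by (intro mult_left_mono) auto
        also have "\<dots> = ((1 + 3 * d) * (1 + d)) * sqrt (real N * ln (ln (real N)))" by simp
        also have "\<dots> \<le> (1 + \<delta>) * sqrt (real N * ln (ln (real N)))"
        proof (rule mult_right_mono[OF _ s0])
          have "d * d \<le> d" using d mult_left_mono[of d 1 d] by simp
          moreover have "(1 + 3 * d) * (1 + d) = 1 + 4 * d + 3 * (d * d)" by (simp add: algebra_simps)
          ultimately show "(1 + 3 * d) * (1 + d) \<le> 1 + \<delta>" using d by linarith
        qed
        finally show "\<bar>S N x\<bar> \<le> (1 + \<delta>) * sqrt (real N * ln (ln (real N)))" using Sw by linarith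
      qed
    qed
    then obtain k0 where k0: "\<And>k N. k \<ge> k0 \<Longrightarrow> 2 ^ k \<le> N \<Longrightarrow> N < 2 ^ (k + 1) \<Longrightarrow>
      \<bar>S N x\<bar> \<le> (1 + \<delta>) * sqrt (real N * ln (ln (real N)))"
      unfolding eventually_sequentially by blast
    have "\<bar>S N x\<bar> \<le> (1 + \<delta>) * sqrt (real N * ln (ln (real N)))" if N: "2 ^ k0 \<le> N" for N
    proof -
      have "(1::nat) \<le> 2 ^ k0" by simp
      then have "1 \<le> N" using N by linarith
      then obtain k where k: "2 ^ k \<le> N" "N < 2 ^ (k + 1)" using ex_power_ivl1[of 2 N] by auto
      have "(2::nat) ^ k0 < 2 ^ (k + 1)" using N k by linarith
      from power_less_imp_less_exp[OF _ this] have "k0 \<le> k" by simp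
      then show ?thesis using k0 k by blast
    qed
    then show ?case by (rule eventually_sequentiallyI)
  qed
qed

end

section \<open>Quasi-independence and exponential tilting\<close>

lemma quasi_independent_io:
  fixes Z :: "nat \<Rightarrow> real \<Rightarrow> real" and a :: "nat \<Rightarrow> real"
  assumes G: "\<And>k. G k \<in> U.events"
    and int1: "\<And>k. integrable unit_interval_space (Z k)"
    and int2: "\<And>j k. integrable unit_interval_space (\<lambda>x. Z j x * Z k x)"
    and nonneg: "\<And>k x. 0 \<le> Z k x"
    and supp: "\<And>k x. x \<notin> G k \<Longrightarrow> Z k x = 0"
    and a: "\<And>k. 0 \<le> a k"
    and bd: "\<And>k x. a k * Z k x \<le> 1"
    and div: "\<not> summable a"
    and lim: "\<And>\<iota>::real. \<iota> > 0 \<Longrightarrow> \<exists>m. \<forall>k\<ge>m. a k > 0 \<longrightarrow>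
      1 - \<iota> \<le> U.expectation (Z k) \<and> U.expectation (Z k) \<le> 1 + \<iota> \<and>
      (\<forall>j\<ge>m. a j > 0 \<longrightarrow> j \<noteq> k \<longrightarrow> U.expectation (\<lambda>x. Z j x * Z k x) \<le> 1 + \<iota>)"
  shows "AE x in unit_interval_space. \<forall>m. \<exists>k\<ge>m. x \<in> G k"
proof -
  define B where "B m = {0..1} - (\<Union>k\<in>{m..}. G k)" for m
  have B: "B m \<in> U.events" for m
    unfolding B_def using sets.top[of unit_interval_space] G by (intro sets.Diff sets.countable_UN'') auto
  have "U.prob (B m) = 0" for m
  proof -
    have small: "U.prob (B m) \<le> 4 * \<iota>" if i: "0 < \<iota>" "\<iota> \<le> 1" for \<iota>
    proof -
      from lim[OF i(1)] obtain m0 where m0: "\<forall>k\<ge>m0. a k > 0 \<longrightarrow>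
        1 - \<iota> \<le> U.expectation (Z k) \<and> U.expectation (Z k) \<le> 1 + \<iota> \<and>
        (\<forall>j\<ge>m0. a j > 0 \<longrightarrow> j \<noteq> k \<longrightarrow> U.expectation (\<lambda>x. Z j x * Z k x) \<le> 1 + \<iota>)" by (elim exE)
      define m1 where "m1 = max m m0"
      obtain N where N: "sum a {m1..<N} \<ge> 2 / \<iota>"
      proof (rule ccontr)
        assume "\<not> thesis"
        then have *: "sum a {m1..<N} < 2 / \<iota>" for N using that by (meson not_le)
        have "summable a"
        proof (rule summableI_nonneg_bounded[OF a])
          fix N
          have "sum a {..<N} \<le> sum a ({..<m1} \<union> {m1..<N})" using a by (intro sum_mono2) auto
          also have "\<dots> = sum a {..<m1} + sum a {m1..<N}" by (intro sum.union_disjoint) auto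
          finally show "sum a {..<N} \<le> sum a {..<m1} + 2 / \<iota>" using *[of N] by linarith
        qed
        then show False using div by blast
      qed
      define I where "I = {k \<in> {m1..<N}. a k > 0}"
      have I: "finite I" "\<And>k. k \<in> I \<Longrightarrow> k \<ge> m \<and> k \<ge> m0 \<and> a k > 0" by (auto simp: I_def m1_def)
      define A where "A = sum a I"
      have "A = sum a {m1..<N}"
        unfolding A_def I_def using a by (intro sum.mono_neutral_left) (auto simp: less_le)
      then have A: "A \<ge> 2 / \<iota>" using N by simp
      have Apos: "A > 0" using A i by (intro less_le_trans[OF _ A]) auto
      define W where "W x = (\<Sum>k\<in>I. a k * Z k x)" for x
      have Wint: "integrable unit_interval_space W"
        unfolding W_def by (intro Bochner_Integration.integrable_sum integrable_mult_right int1)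
      have W2: "(W x)\<^sup>2 = (\<Sum>j\<in>I. \<Sum>k\<in>I. (a j * a k) * (Z j x * Z k x))" for x
        unfolding W_def power2_eq_square sum_product by (simp add: mult_ac)
      have W2int: "integrable unit_interval_space (\<lambda>x. (W x)\<^sup>2)"
        unfolding W2 by (intro Bochner_Integration.integrable_sum integrable_mult_right int2)
      have EW: "U.expectation W = (\<Sum>k\<in>I. a k * U.expectation (Z k))"
        unfolding W_def by (simp add: int1)
      have EW2: "U.expectation (\<lambda>x. (W x)\<^sup>2) = (\<Sum>j\<in>I. \<Sum>k\<in>I. (a j * a k) * U.expectation (\<lambda>x. Z j x * Z k x))"
        unfolding W2 by (simp add: int2 Bochner_Integration.integrable_sum)
      have low: "(1 - \<iota>) * A \<le> U.expectation W"
      proof -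
        have "(1 - \<iota>) * A = (\<Sum>k\<in>I. a k * (1 - \<iota>))" by (simp add: A_def sum_distrib_left mult.commute)
        also have "\<dots> \<le> U.expectation W"
          unfolding EW using m0 I a by (intro sum_mono mult_left_mono) auto
        finally show ?thesis .
      qed
      have up: "U.expectation (\<lambda>x. (W x)\<^sup>2) \<le> (1 + \<iota>) * (A * A) + (1 + \<iota>) * A"
      proof -
        have "(a j * a k) * U.expectation (\<lambda>x. Z j x * Z k x) \<le> (1 + \<iota>) * (a j * a k) + (if j = k then (1 + \<iota>) * a j else 0)"
          if jk: "j \<in> I" "k \<in> I" for j k
        proof (cases "j = k")
          case True
          have "(a k * a k) * U.expectation (\<lambda>x. Z k x * Z k x) = U.expectation (\<lambda>x. (a k * Z k x) * (a k * Z k x))"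
            by (subst integral_mult_right_zero[symmetric]) (simp add: mult_ac)
          also have "\<dots> \<le> U.expectation (\<lambda>x. a k * Z k x)"
          proof (rule integral_mono)
            show "integrable unit_interval_space (\<lambda>x. (a k * Z k x) * (a k * Z k x))"
              using integrable_mult_right[OF int2[of k k], of "a k * a k"] by (simp add: mult_ac)
            show "(a k * Z k x) * (a k * Z k x) \<le> a k * Z k x" for x
              using mult_left_mono[OF bd[of k x], of "a k * Z k x"] a nonneg by simp
          qed (intro integrable_mult_right int1)
          also have "\<dots> \<le> a k * (1 + \<iota>)" using m0 I jk a by (auto intro!: mult_left_mono)
          finally show ?thesis using True i a[of k] by (simp add: mult.commute add_increasing)
        next
          case False
          have "(a j * a k) * U.expectation (\<lambda>x. Z j x * Z k x) \<le> (a j * a k) * (1 + \<iota>)"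
            using m0 I jk a False by (intro mult_left_mono) auto
          then show ?thesis using False by (simp add: mult.commute)
        qed
        then have "U.expectation (\<lambda>x. (W x)\<^sup>2) \<le>
            (\<Sum>j\<in>I. \<Sum>k\<in>I. (1 + \<iota>) * (a j * a k) + (if j = k then (1 + \<iota>) * a j else 0))"
          unfolding EW2 by (intro sum_mono) auto
        also have "\<dots> = (1 + \<iota>) * (A * A) + (1 + \<iota>) * A"
          using I(1) unfolding A_def sum_product
          by (simp add: sum.distrib sum_distrib_left)
        finally show ?thesis .
      qed
      have W0: "W x = 0" if "x \<in> B m" for x
        unfolding W_def using that I(2) supp by (intro sum.neutral) (auto simp: B_def)
      have "A\<^sup>2 * U.prob (B m) = U.expectation (\<lambda>x. A\<^sup>2 * indicator (B m) x)"
        using B Int_absorb2[of "B m" "{0..1}"] by (simp add: B_def)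
      also have "\<dots> \<le> U.expectation (\<lambda>x. (W x)\<^sup>2 - 2 * A * W x + A\<^sup>2)"
      proof (rule integral_mono)
        show "integrable unit_interval_space (\<lambda>x. A\<^sup>2 * indicator (B m) x)"
          using B by (intro integrable_mult_right integrable_real_indicator) (auto simp: U.emeasure_eq_measure)
        show "integrable unit_interval_space (\<lambda>x. (W x)\<^sup>2 - 2 * A * W x + A\<^sup>2)"
          using W2int Wint by simp
        fix x
        have "0 \<le> (W x - A)\<^sup>2" by simp
        then show "A\<^sup>2 * indicator (B m) x \<le> (W x)\<^sup>2 - 2 * A * W x + A\<^sup>2"
          using W0[of x] by (auto simp: indicator_def power2_diff mult_ac)
      qed
      also have "\<dots> = U.expectation (\<lambda>x. (W x)\<^sup>2) - 2 * A * U.expectation W + A\<^sup>2"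
        using W2int Wint U.prob_space by simp
      also have "\<dots> \<le> 3 * \<iota> * A\<^sup>2 + 2 * A"
      proof -
        have "2 * A * ((1 - \<iota>) * A) \<le> 2 * A * U.expectation W" using low Apos by (intro mult_left_mono) auto
        moreover have "(1 + \<iota>) * A \<le> 2 * A" using i Apos by (intro mult_right_mono) auto
        ultimately show ?thesis using up by (simp add: algebra_simps power2_eq_square)
      qed
      also have "2 * A \<le> \<iota> * A\<^sup>2"
        using A i Apos mult_right_mono[of 2 "\<iota> * A" A] by (simp add: field_simps power2_eq_square)
      finally have "A\<^sup>2 * U.prob (B m) \<le> A\<^sup>2 * (4 * \<iota>)" by (simp add: algebra_simps)
      then show ?thesis using Apos by simp
    qed
    have "U.prob (B m) \<le> 0 + e" if "e > 0" for e
    proof -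
      have "U.prob (B m) \<le> 4 * min 1 (e / 4)" by (rule small) (use that in auto)
      also have "\<dots> \<le> 0 + e" using min.cobounded2[of 1 "e / 4"] by linarith
      finally show ?thesis .
    qed
    then have "U.prob (B m) \<le> 0" by (rule field_le_epsilon)
    then show ?thesis by (simp add: measure_le_0_iff)
  qed
  then have "AE x in unit_interval_space. x \<notin> B m" for m
    using B by (simp add: U.prob_eq_0)
  then have "AE x in unit_interval_space. \<forall>m. x \<notin> B m" by (simp add: AE_all_countable)
  moreover have "AE x in unit_interval_space. x \<in> {0..1}"
    using AE_space[of unit_interval_space] by simp
  ultimately show ?thesis
    by eventually_elim (auto simp: B_def)
qed

context lacunary
begin

lemma unweighted_continuous [continuous_intros]: "continuous_on A (unweighted B)"
  unfolding unweighted_def by (rule block_sum_continuous)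

lemma unweighted_measurable [measurable]: "unweighted B \<in> borel_measurable borel"
  unfolding unweighted_def by (rule block_sum_measurable)

lemma block_sum_const: "block_sum (\<lambda>_. u) B x = u * unweighted B x"
  by (simp add: unweighted_def block_sum_def sum_distrib_left)

lemma unweighted_mgf:
  fixes u :: real
  assumes "separated L B" "L * \<bar>u\<bar> \<le> 1 / 2"
  shows "U.expectation (\<lambda>x. exp (u * unweighted B x)) \<le> exp (u\<^sup>2 * card B / 4 + real L ^ 3 * (card B * \<bar>u\<bar> ^ 3))"
  using exp_moment_upper[of L B "\<lambda>_. u"] assms by (simp add: block_sum_const mult_ac)

definition tilt :: "real \<Rightarrow> nat set \<Rightarrow> real \<Rightarrow> real" where
  "tilt u B x = exp (u * unweighted B x - u\<^sup>2 * card B / 4)"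

lemma tilt_continuous [continuous_intros]: "continuous_on A (tilt u B)"
  unfolding tilt_def by (intro continuous_intros) auto

lemma tilt_integrable: "integrable unit_interval_space (tilt u B)"
  by (intro unit_interval_integrable tilt_continuous)

lemma tilt_eq: "tilt u B x = exp (- u\<^sup>2 * card B / 4) * exp (u * unweighted B x)"
  by (simp add: tilt_def flip: exp_add)

lemma tilt_expectation:
  fixes u :: real
  assumes "separated L B" "L * \<bar>u\<bar> \<le> 1 / 2"
  shows "U.expectation (tilt u B) \<le> exp (real L ^ 3 * (card B * \<bar>u\<bar> ^ 3))"
    and "exp (- 2 * (real L ^ 3 * (card B * \<bar>u\<bar> ^ 3))) \<le> U.expectation (tilt u B)"
proof -
  have eq: "U.expectation (tilt u B) = exp (- u\<^sup>2 * card B / 4) * U.expectation (\<lambda>x. exp (u * unweighted B x))"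
    unfolding tilt_eq by simp
  show "U.expectation (tilt u B) \<le> exp (real L ^ 3 * (card B * \<bar>u\<bar> ^ 3))"
    using mult_left_mono[OF unweighted_mgf[OF assms], of "exp (- u\<^sup>2 * card B / 4)"]
    by (simp add: eq flip: exp_add)
  have "exp (u\<^sup>2 * card B / 4 - 2 * (real L ^ 3 * (card B * \<bar>u\<bar> ^ 3))) \<le> U.expectation (\<lambda>x. exp (u * unweighted B x))"
    using exp_moment_lower[of L B "\<lambda>_. u"] assms by (simp add: block_sum_const mult_ac)
  from mult_left_mono[OF this, of "exp (- u\<^sup>2 * card B / 4)"]
  show "exp (- 2 * (real L ^ 3 * (card B * \<bar>u\<bar> ^ 3))) \<le> U.expectation (tilt u B)"
    by (simp add: eq flip: exp_add)
qed

lemma tilt_pair_expectation: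
  fixes u u' :: real
  assumes sep: "separated L (B \<union> B')" and disj: "B \<inter> B' = {}"
    and u: "L * \<bar>u\<bar> \<le> 1 / 2" "L * \<bar>u'\<bar> \<le> 1 / 2"
  shows "U.expectation (\<lambda>x. tilt u B x * tilt u' B' x) \<le>
    exp (real L ^ 3 * (card B * \<bar>u\<bar> ^ 3) + real L ^ 3 * (card B' * \<bar>u'\<bar> ^ 3))"
proof -
  let ?c = "\<lambda>k. if k \<in> B then u else u'"
  have fin: "finite B" "finite B'" using sep by (auto simp: separated_def)
  have split: "(\<Sum>k\<in>B \<union> B'. f (?c k) k) = (\<Sum>k\<in>B. f u k) + (\<Sum>k\<in>B'. f u' k)" for f :: "real \<Rightarrow> nat \<Rightarrow> real"
  proof -
    have "(\<Sum>k\<in>B \<union> B'. f (?c k) k) = (\<Sum>k\<in>B. f (?c k) k) + (\<Sum>k\<in>B'. f (?c k) k)"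
      using fin disj by (rule sum.union_disjoint)
    also have "(\<Sum>k\<in>B'. f (?c k) k) = (\<Sum>k\<in>B'. f u' k)" using disj by (intro sum.cong) auto
    finally show ?thesis by simp
  qed
  have bs: "block_sum ?c (B \<union> B') x = u * unweighted B x + u' * unweighted B' x" for x
    unfolding block_sum_def using split[of "\<lambda>c k. c * cos (2 * pi * real (n k) * x)"]
    by (simp add: unweighted_def block_sum_def sum_distrib_left)
  have prod: "tilt u B x * tilt u' B' x = exp (- (u\<^sup>2 * card B / 4 + u'\<^sup>2 * card B' / 4)) * exp (block_sum ?c (B \<union> B') x)" for x
    by (simp add: tilt_def bs algebra_simps flip: exp_add)
  have "U.expectation (\<lambda>x. exp (block_sum ?c (B \<union> B') x)) \<le>
    exp ((\<Sum>k\<in>B \<union> B'. (?c k)\<^sup>2) / 4 + real L ^ 3 * (\<Sum>k\<in>B \<union> B'. \<bar>?c k\<bar> ^ 3))"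
    by (rule exp_moment_upper[OF sep]) (use u in auto)
  also have "(\<Sum>k\<in>B \<union> B'. (?c k)\<^sup>2) / 4 + real L ^ 3 * (\<Sum>k\<in>B \<union> B'. \<bar>?c k\<bar> ^ 3) =
    (u\<^sup>2 * card B / 4 + u'\<^sup>2 * card B' / 4) + (real L ^ 3 * (card B * \<bar>u\<bar> ^ 3) + real L ^ 3 * (card B' * \<bar>u'\<bar> ^ 3))"
    using split[of "\<lambda>c k. c\<^sup>2"] split[of "\<lambda>c k. \<bar>c\<bar> ^ 3"]
    by (simp add: algebra_simps add_divide_distrib)
  finally have "U.expectation (\<lambda>x. exp (block_sum ?c (B \<union> B') x)) \<le>
    exp ((u\<^sup>2 * card B / 4 + u'\<^sup>2 * card B' / 4) + (real L ^ 3 * (card B * \<bar>u\<bar> ^ 3) + real L ^ 3 * (card B' * \<bar>u'\<bar> ^ 3)))" .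
  from mult_left_mono[OF this exp_ge_zero[of "- (u\<^sup>2 * card B / 4 + u'\<^sup>2 * card B' / 4)"]]
  show ?thesis unfolding prod integral_mult_right_zero
    by (rule order_trans) (simp flip: exp_add)
qed

lemma tilt_concentration:
  fixes \<eta> u :: real
  assumes sep: "separated L B" and u: "0 \<le> u" "L * u \<le> 1 / 4" and eta: "0 < \<eta>" "\<eta> \<le> 1"
  shows "U.expectation (\<lambda>x. tilt u B x * indicator {x. \<eta> * (u * card B / 2) < \<bar>unweighted B x - u * card B / 2\<bar>} x) \<le>
    2 * exp (8 * (real L ^ 3 * (card B * u ^ 3)) - \<eta>\<^sup>2 * u\<^sup>2 * card B / 4)"
proof -
  let ?b = "real (card B)" and ?X = "unweighted B"
  let ?m = "u * ?b / 2"
  define t where "t = \<eta> * u"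
  have t: "0 \<le> t" "t \<le> u" using u eta mult_right_mono[of \<eta> 1 u] by (auto simp: t_def)
  have one: "U.expectation (\<lambda>x. tilt u B x * exp (\<delta> * t * (?X x - ?m) - t * (\<eta> * ?m))) \<le>
    exp (8 * (real L ^ 3 * (?b * u ^ 3)) - \<eta>\<^sup>2 * u\<^sup>2 * ?b / 4)" if d: "\<delta> = 1 \<or> \<delta> = - 1" for \<delta> :: real
  proof -
    have abs: "\<bar>u + \<delta> * t\<bar> \<le> 2 * u" using t d by auto
    have "tilt u B x * exp (\<delta> * t * (?X x - ?m) - t * (\<eta> * ?m)) =
      exp (- u\<^sup>2 * ?b / 4 - \<delta> * t * ?m - t * (\<eta> * ?m)) * exp ((u + \<delta> * t) * ?X x)" for x
      by (simp add: tilt_def algebra_simps flip: exp_add)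
    then have "U.expectation (\<lambda>x. tilt u B x * exp (\<delta> * t * (?X x - ?m) - t * (\<eta> * ?m))) =
      exp (- u\<^sup>2 * ?b / 4 - \<delta> * t * ?m - t * (\<eta> * ?m)) * U.expectation (\<lambda>x. exp ((u + \<delta> * t) * ?X x))"
      by simp
    also have "\<dots> \<le> exp (- u\<^sup>2 * ?b / 4 - \<delta> * t * ?m - t * (\<eta> * ?m)) *
        exp ((u + \<delta> * t)\<^sup>2 * ?b / 4 + real L ^ 3 * (?b * \<bar>u + \<delta> * t\<bar> ^ 3))"
    proof (intro mult_left_mono unweighted_mgf[OF sep])
      have "L * \<bar>u + \<delta> * t\<bar> \<le> L * (2 * u)" using abs by (intro mult_left_mono) auto
      then show "L * \<bar>u + \<delta> * t\<bar> \<le> 1 / 2" using u by simp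
    qed auto
    also have "\<dots> = exp (real L ^ 3 * (?b * \<bar>u + \<delta> * t\<bar> ^ 3) - \<eta>\<^sup>2 * u\<^sup>2 * ?b / 4)"
    proof -
      have "\<delta>\<^sup>2 = 1" using d by auto
      then have "(u + \<delta> * t)\<^sup>2 = u\<^sup>2 + 2 * \<delta> * t * u + t\<^sup>2" by (simp add: power2_sum power_mult_distrib)
      then show ?thesis
        by (simp add: t_def power2_eq_square algebra_simps flip: exp_add) blast
    qed
    also have "\<dots> \<le> exp (8 * (real L ^ 3 * (?b * u ^ 3)) - \<eta>\<^sup>2 * u\<^sup>2 * ?b / 4)"
    proof -
      have "\<bar>u + \<delta> * t\<bar> ^ 3 \<le> (2 * u) ^ 3" using abs by (intro power_mono) auto
      then have "real L ^ 3 * (?b * \<bar>u + \<delta> * t\<bar> ^ 3) \<le> real L ^ 3 * (?b * (2 * u) ^ 3)"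
        by (intro mult_left_mono) auto
      then show ?thesis by (simp add: power_mult_distrib)
    qed
    finally show ?thesis .
  qed
  have int: "integrable unit_interval_space (\<lambda>x. tilt u B x * exp (\<delta> * t * (?X x - ?m) - t * (\<eta> * ?m)))" for \<delta>
    by (intro unit_interval_integrable continuous_intros)
  have "U.expectation (\<lambda>x. tilt u B x * indicator {x. \<eta> * ?m < \<bar>?X x - ?m\<bar>} x) \<le>
    U.expectation (\<lambda>x. tilt u B x * exp (1 * t * (?X x - ?m) - t * (\<eta> * ?m)) + tilt u B x * exp (- 1 * t * (?X x - ?m) - t * (\<eta> * ?m)))"
  proof (rule integral_mono)
    have "{x \<in> space unit_interval_space. \<eta> * ?m < \<bar>?X x - ?m\<bar>} \<in> U.events"
      using unit_interval_measurable[OF unweighted_measurable[of B]] by measurable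
    then have "integrable unit_interval_space (\<lambda>x. tilt u B x * indicator {x \<in> space unit_interval_space. \<eta> * ?m < \<bar>?X x - ?m\<bar>} x)"
      by (rule integrable_real_mult_indicator[OF _ tilt_integrable])
    then show "integrable unit_interval_space (\<lambda>x. tilt u B x * indicator {x. \<eta> * ?m < \<bar>?X x - ?m\<bar>} x)"
      by (rule Bochner_Integration.integrable_cong[THEN iffD1, rotated 2]) (auto simp: indicator_def)
    show "integrable unit_interval_space (\<lambda>x. tilt u B x * exp (1 * t * (?X x - ?m) - t * (\<eta> * ?m)) + tilt u B x * exp (- 1 * t * (?X x - ?m) - t * (\<eta> * ?m)))"
      by (intro Bochner_Integration.integrable_add int)
    fix x
    have "1 \<le> exp (1 * t * (?X x - ?m) - t * (\<eta> * ?m)) + exp (- 1 * t * (?X x - ?m) - t * (\<eta> * ?m))"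
      if "\<eta> * ?m < \<bar>?X x - ?m\<bar>"
    proof -
      have "t * (\<eta> * ?m) \<le> t * \<bar>?X x - ?m\<bar>" using that t by (intro mult_left_mono) auto
      then have "0 \<le> 1 * t * (?X x - ?m) - t * (\<eta> * ?m) \<or> 0 \<le> - 1 * t * (?X x - ?m) - t * (\<eta> * ?m)"
        by (auto simp: abs_if algebra_simps split: if_splits)
      then show ?thesis
        using exp_ge_zero[of "1 * t * (?X x - ?m) - t * (\<eta> * ?m)"] exp_ge_zero[of "- 1 * t * (?X x - ?m) - t * (\<eta> * ?m)"]
          one_le_exp_iff by (metis add_increasing add_increasing2)
    qed
    then have "indicator {x. \<eta> * ?m < \<bar>?X x - ?m\<bar>} x \<le> exp (1 * t * (?X x - ?m) - t * (\<eta> * ?m)) + exp (- 1 * t * (?X x - ?m) - t * (\<eta> * ?m))"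
      by (auto simp: indicator_def)
    from mult_left_mono[OF this, of "tilt u B x"]
    show "tilt u B x * indicator {x. \<eta> * ?m < \<bar>?X x - ?m\<bar>} x \<le>
      tilt u B x * exp (1 * t * (?X x - ?m) - t * (\<eta> * ?m)) + tilt u B x * exp (- 1 * t * (?X x - ?m) - t * (\<eta> * ?m))"
      by (simp add: tilt_def distrib_left)
  qed
  also have "\<dots> = U.expectation (\<lambda>x. tilt u B x * exp (1 * t * (?X x - ?m) - t * (\<eta> * ?m))) +
     U.expectation (\<lambda>x. tilt u B x * exp (- 1 * t * (?X x - ?m) - t * (\<eta> * ?m)))"
    by (intro Bochner_Integration.integral_add int)
  also have "\<dots> \<le> 2 * exp (8 * (real L ^ 3 * (?b * u ^ 3)) - \<eta>\<^sup>2 * u\<^sup>2 * ?b / 4)"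
    using add_mono[OF one[of 1] one[of "- 1"]] by simp
  finally show ?thesis .
qed

end

locale tilted_blocks = permuted_lacunary +
  fixes d :: real and \<theta> g L :: nat and sh :: "nat \<Rightarrow> nat"
  assumes d: "0 < d" "d \<le> 1 / 7"
    and theta: "2 \<le> \<theta>" "4 / d\<^sup>2 \<le> \<theta>"
    and g: "K \<le> q ^ g"
    and L: "0 < L" "g / (L + g) \<le> d\<^sup>2 / 4"
    and sh: "\<And>k. sh k < L + g"
      "\<And>k. (L + g) * card {i \<in> \<sigma> ` {\<theta> ^ (k - 1)<..\<theta> ^ k}. \<not> (i + sh k) mod (L + g) < L}
         \<le> g * card (\<sigma> ` {\<theta> ^ (k - 1)<..\<theta> ^ k})"
begin

definition Ak :: "nat \<Rightarrow> nat set" where "Ak k = \<sigma> ` {\<theta> ^ (k - 1)<..\<theta> ^ k}"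
definition Bk :: "nat \<Rightarrow> nat set" where "Bk k = {i \<in> Ak k. (i + sh k) mod (L + g) < L}"
definition Rk :: "nat \<Rightarrow> nat set" where "Rk k = {i \<in> Ak k. \<not> (i + sh k) mod (L + g) < L}"
definition v :: "nat \<Rightarrow> real" where "v k = sqrt (\<theta> ^ k * ln k)"
definition l :: "nat \<Rightarrow> real" where "l k = 2 * (1 - d) * sqrt (ln k / \<theta> ^ k)"

lemma Ak: "finite (Ak k)" "Ak k \<subseteq> {1..}" "card (Ak k) = \<theta> ^ k - \<theta> ^ (k - 1)"
  unfolding Ak_def by (simp_all add: sigma_image card_sigma_image del: One_nat_def)

lemma theta_pos: "real \<theta> > 0" "real \<theta> ^ k > 0"
  using theta by auto

lemma card_Rk: "card (Rk k) \<le> d\<^sup>2 / 4 * \<theta> ^ k"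
proof -
  have "(L + g) * card (Rk k) \<le> g * card (Ak k)"
    using sh(2)[of k] by (simp add: Rk_def Ak_def)
  then have "real (L + g) * card (Rk k) \<le> g * card (Ak k)"
    by (simp only: of_nat_mult[symmetric] of_nat_le_iff)
  then have "card (Rk k) \<le> g / (L + g) * card (Ak k)" using L by (simp add: field_simps)
  also have "\<dots> \<le> d\<^sup>2 / 4 * \<theta> ^ k" using L by (intro mult_mono) (auto simp: Ak of_nat_diff power_increasing)
  finally show ?thesis .
qed

lemma card_Bk:
  shows "card (Bk k) \<le> real \<theta> ^ k" and "1 \<le> k \<Longrightarrow> (1 - d) * \<theta> ^ k \<le> card (Bk k)"
proof -
  have "card (Bk k) \<le> card (Ak k)" unfolding Bk_def by (rule card_mono) (auto simp: Ak)
  also have "\<dots> \<le> \<theta> ^ k" by (simp add: Ak)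
  finally show "card (Bk k) \<le> real \<theta> ^ k" by (metis of_nat_le_iff of_nat_power)
  assume k: "1 \<le> k"
  have "Ak k = Bk k \<union> Rk k" "Bk k \<inter> Rk k = {}" "finite (Bk k)" "finite (Rk k)"
    using Ak by (auto simp: Bk_def Rk_def)
  then have "card (Ak k) = card (Bk k) + card (Rk k)" by (metis card_Un_disjoint)
  moreover have "real (card (Ak k)) = real \<theta> ^ k - real \<theta> ^ (k - 1)"
    using theta by (simp add: Ak of_nat_diff power_increasing)
  moreover have "real \<theta> ^ (k - 1) \<le> d\<^sup>2 / 4 * real \<theta> ^ k"
  proof -
    have "1 \<le> d\<^sup>2 / 4 * real \<theta>" using theta d by (simp add: field_simps)
    from mult_right_mono[OF this, of "real \<theta> ^ (k - 1)"] show ?thesis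
      using k by (cases k) auto
  qed
  moreover have "d\<^sup>2 / 4 * real \<theta> ^ k + d\<^sup>2 / 4 * real \<theta> ^ k \<le> d * real \<theta> ^ k"
  proof -
    have "d\<^sup>2 / 4 + d\<^sup>2 / 4 \<le> d" using d mult_right_mono[of d 1 d] by (simp add: power2_eq_square)
    from mult_right_mono[OF this, of "real \<theta> ^ k"] show ?thesis by (simp add: algebra_simps)
  qed
  ultimately show "(1 - d) * \<theta> ^ k \<le> card (Bk k)"
    using card_Rk[of k] by (simp add: algebra_simps)
qed

lemma separated_Bk: "separated L (Bk k)"
  unfolding Bk_def by (rule separated_shift[OF Ak(1,2) g L(1)])

lemma separated_pair:
  assumes "sh j = sh k" shows "separated L (Bk j \<union> Bk k)"
proof (rule separated_subset)
  show "separated L {i \<in> Ak j \<union> Ak k. (i + sh k) mod (L + g) < L}"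
    by (rule separated_shift[OF _ _ g L(1)]) (use Ak in auto)
qed (use assms in \<open>auto simp: Bk_def\<close>)

lemma Bk_disjoint:
  assumes "j \<noteq> k" shows "Bk j \<inter> Bk k = {}"
proof -
  have "Ak j \<inter> Ak k = {}" if "j < k" for j k
  proof -
    have "\<theta> ^ j \<le> \<theta> ^ (k - 1)" using that theta by (intro power_increasing) auto
    then have "{\<theta> ^ (j - 1)<..\<theta> ^ j} \<inter> {\<theta> ^ (k - 1)<..\<theta> ^ k} = {}" by auto
    moreover have "inj_on \<sigma> ({\<theta> ^ (j - 1)<..\<theta> ^ j} \<union> {\<theta> ^ (k - 1)<..\<theta> ^ k})" by (rule inj_sigma) auto
    ultimately show ?thesis unfolding Ak_def by (metis inj_on_image_Int image_empty sup_ge1 sup_ge2)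
  qed
  from this[of j k] this[of k j] assms show ?thesis by (auto simp: Bk_def neq_iff)
qed

lemma l_nonneg: "0 \<le> l k"
  using d by (cases "k = 0") (auto simp: l_def)

lemma l_sq: "1 \<le> k \<Longrightarrow> (l k)\<^sup>2 * \<theta> ^ k = 4 * (1 - d)\<^sup>2 * ln k"
proof -
  assume "1 \<le> k"
  then have "(sqrt (ln k / \<theta> ^ k))\<^sup>2 = ln k / \<theta> ^ k" by simp
  then show ?thesis unfolding l_def power_mult_distrib using theta_pos by simp
qed

lemma l_le: "l k \<le> 2 * sqrt (ln k / 2 ^ k)"
proof (cases "k = 0")
  case False
  have "2 ^ k \<le> real \<theta> ^ k" using theta by (intro power_mono) auto
  then have "ln k / real \<theta> ^ k \<le> ln k / 2 ^ k" using False by (intro divide_left_mono) auto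
  then show ?thesis unfolding l_def using d False by (intro mult_mono) auto
qed (simp add: l_def)

lemma error_le: "real L ^ 3 * (card (Bk k) * (l k) ^ 3) \<le> real L ^ 3 * (8 * ln k * sqrt (ln k / 2 ^ k))"
proof (cases "k = 0")
  case False
  have "card (Bk k) * (l k) ^ 3 \<le> \<theta> ^ k * (l k) ^ 3"
    using l_nonneg card_Bk(1) by (intro mult_right_mono) auto
  also have "\<dots> = ((l k)\<^sup>2 * \<theta> ^ k) * l k" by (simp add: eval_nat_numeral)
  also have "\<dots> = 4 * (1 - d)\<^sup>2 * ln k * l k" using l_sq False by simp
  also have "\<dots> \<le> 4 * 1 * ln k * (2 * sqrt (ln k / 2 ^ k))"
    using d False l_le[of k] l_nonneg[of k] by (intro mult_mono) (auto simp: power_le_one)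
  finally show ?thesis by (intro mult_left_mono) auto
qed (simp add: l_def)

lemma eventually_Rk_small:
  "AE x in unit_interval_space. \<forall>\<^sub>F k in sequentially. \<bar>unweighted (Rk k) x\<bar> \<le> d * v k"
proof -
  let ?A = "\<lambda>k. {x \<in> {0..1}. d * v k \<le> \<bar>unweighted (Rk k) x\<bar>}"
  from unweighted_tail[of 1, OF zero_less_one] obtain u0 where u0: "u0 > 0" "\<forall>A u t. finite A \<and> A \<subseteq> {1..} \<and> 0 < (u::real) \<and> u \<le> u0 \<longrightarrow>
      U.prob {x \<in> {0..1}. t \<le> \<bar>unweighted A x\<bar>} \<le> 2 * exp ((1 + 1) * u\<^sup>2 * card A / 4 - u * t)"
    by (elim exE conjE)
  have ev: "?A k \<in> U.events" for k
  proof -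
    have "(\<lambda>x. \<bar>unweighted (Rk k) x\<bar>) \<in> borel_measurable unit_interval_space"
      by (rule unit_interval_measurable) measurable
    from measurable_sets[OF this, of "{d * v k..}"] show ?thesis
      by (simp add: vimage_def Int_def conj_commute)
  qed
  have "(\<lambda>k. 4 / d * sqrt (ln (real k) / 2 ^ k)) \<longlonglongrightarrow> 4 / d * 0"
    by (intro tendsto_mult tendsto_const) real_asymp
  then have "\<forall>\<^sub>F k in sequentially. 4 / d * sqrt (ln (real k) / 2 ^ k) < u0"
    by (rule order_tendstoD) (use u0 in simp)
  then have "\<forall>\<^sub>F k in sequentially. U.prob (?A k) \<le> 2 * inverse (real k ^ 2)"
    using eventually_ge_at_top[of 3]
  proof eventually_elim
    case (elim k)
    have lnk: "ln (real k) > 0" using elim by simp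
    define M where "M = real \<theta> ^ k"
    have M: "M > 0" "2 ^ k \<le> M" using theta by (auto simp: M_def intro: power_mono)
    define u where "u = 4 / d * sqrt (ln k / M)"
    have upos: "u > 0" using lnk M d by (simp add: u_def)
    have "u \<le> 4 / d * sqrt (ln k / 2 ^ k)"
      unfolding u_def using M lnk d by (intro mult_left_mono real_sqrt_le_mono divide_left_mono) auto
    then have ule: "u \<le> u0" using elim by linarith
    have usq: "u\<^sup>2 = 16 / d\<^sup>2 * (ln k / M)"
      using lnk M by (simp add: u_def power_mult_distrib power_divide)
    have ut: "u * (d * v k) = 4 * ln k"
    proof -
      have "sqrt (ln k / M) * sqrt (M * ln k) = ln k" using lnk M by (simp flip: real_sqrt_mult)
      then show ?thesis using d by (simp add: u_def v_def flip: M_def)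
    qed
    have "U.prob (?A k) \<le> 2 * exp ((1 + 1) * u\<^sup>2 * card (Rk k) / 4 - u * (d * v k))"
      by (rule u0(2)[rule_format]) (use upos ule Ak in \<open>auto simp: Rk_def\<close>)
    also have "\<dots> \<le> 2 * exp (- 2 * ln k)"
    proof -
      have "u\<^sup>2 * card (Rk k) \<le> u\<^sup>2 * (d\<^sup>2 / 4 * M)"
        using card_Rk[of k] by (intro mult_left_mono) (auto simp: M_def)
      also have "\<dots> = 4 * ln k" using M d by (simp add: usq)
      finally show ?thesis unfolding ut by simp
    qed
    also have "exp (- 2 * ln k) = inverse (real k ^ 2)"
      using elim by (simp add: exp_minus exp_double)
    finally show ?case .
  qed
  moreover have "summable (\<lambda>k. 2 * inverse (real k ^ 2))"
    by (intro summable_mult inverse_power_summable) simp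
  ultimately have "AE x in unit_interval_space. \<forall>\<^sub>F k in sequentially. x \<notin> ?A k"
    by (intro AE_eventually_notin ev)
  moreover have "AE x in unit_interval_space. x \<in> {0..1}"
    using AE_space[of unit_interval_space] by simp
  ultimately show ?thesis
  proof eventually_elim
    case (elim x)
    from elim(1) show ?case
      by eventually_elim (use elim(2) in auto)
  qed
qed

definition Gk :: "nat \<Rightarrow> real set" where
  "Gk k = {x \<in> {0..1}. \<bar>unweighted (Bk k) x - l k * card (Bk k) / 2\<bar> \<le> d / 2 * (l k * card (Bk k) / 2)}"

definition Zk :: "nat \<Rightarrow> real \<Rightarrow> real" where
  "Zk k x = tilt (l k) (Bk k) x * indicator (Gk k) x"

lemma Gk_event: "Gk k \<in> U.events"
proof -
  have "(\<lambda>x. \<bar>unweighted (Bk k) x - l k * card (Bk k) / 2\<bar>) \<in> borel_measurable unit_interval_space"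
    by (rule unit_interval_measurable) measurable
  from measurable_sets[OF this, of "{..d / 2 * (l k * card (Bk k) / 2)}"] show ?thesis
    by (simp add: vimage_def Int_def conj_commute Gk_def)
qed

lemma Zk_nonneg: "0 \<le> Zk k x"
  by (simp add: Zk_def tilt_def)

lemma Zk_outside: "x \<notin> Gk k \<Longrightarrow> Zk k x = 0"
  by (simp add: Zk_def)

lemma Zk_le_tilt: "Zk k x \<le> tilt (l k) (Bk k) x"
  by (simp add: Zk_def tilt_def indicator_def)

lemma Zk_integrable: "integrable unit_interval_space (Zk k)"
  unfolding Zk_def by (rule integrable_real_mult_indicator[OF Gk_event tilt_integrable])

lemma tilt_pair_integrable: "integrable unit_interval_space (\<lambda>x. tilt u B x * tilt u' B' x)"
  by (intro unit_interval_integrable continuous_intros)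

lemma Zk_pair_integrable: "integrable unit_interval_space (\<lambda>x. Zk j x * Zk k x)"
proof -
  have "integrable unit_interval_space (\<lambda>x. (tilt (l j) (Bk j) x * tilt (l k) (Bk k) x) * indicator (Gk j \<inter> Gk k) x)"
    by (rule integrable_real_mult_indicator[OF sets.Int[OF Gk_event Gk_event] tilt_pair_integrable])
  then show ?thesis by (simp add: Zk_def indicator_inter_arith mult_ac)
qed

lemma Zk_bound: "k powr - (1 - d) * Zk k x \<le> 1"
proof (cases "x \<in> Gk k \<and> k \<noteq> 0")
  case True
  let ?b = "real (card (Bk k))"
  have k: "k \<ge> 1" "k > 0" using True by auto
  have "unweighted (Bk k) x \<le> (1 + d / 2) * (l k * ?b / 2)"
  proof -
    have "\<bar>unweighted (Bk k) x - l k * ?b / 2\<bar> \<le> d / 2 * (l k * ?b / 2)"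
      using True by (simp only: Gk_def mem_Collect_eq)
    from abs_le_D1[OF this] show ?thesis by (simp add: algebra_simps)
  qed
  then have "l k * unweighted (Bk k) x \<le> l k * ((1 + d / 2) * (l k * ?b / 2))"
    using l_nonneg by (intro mult_left_mono) auto
  then have "l k * unweighted (Bk k) x - (l k)\<^sup>2 * ?b / 4 \<le> (l k)\<^sup>2 * ?b * (1 + d) / 4"
    by (simp add: algebra_simps power2_eq_square)
  also have "\<dots> \<le> (l k)\<^sup>2 * \<theta> ^ k * (1 + d) / 4"
    using card_Bk(1)[of k] d by (intro divide_right_mono mult_right_mono mult_left_mono) auto
  also have "\<dots> = ((1 - d)\<^sup>2 * (1 + d)) * ln k" unfolding l_sq[OF k(1)] by simp
  also have "\<dots> \<le> (1 - d) * ln k"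
  proof (rule mult_right_mono)
    have "(1 - d)\<^sup>2 * (1 + d) = (1 - d) * (1 - d\<^sup>2)" by (simp add: power2_eq_square algebra_simps)
    also have "\<dots> \<le> (1 - d) * 1" using d by (intro mult_left_mono) auto
    finally show "(1 - d)\<^sup>2 * (1 + d) \<le> 1 - d" by simp
  qed (use k in auto)
  finally have "tilt (l k) (Bk k) x \<le> exp ((1 - d) * ln k)" by (simp add: tilt_def)
  then have "exp (- (1 - d) * ln k) * tilt (l k) (Bk k) x \<le> exp (- (1 - d) * ln k) * exp ((1 - d) * ln k)"
    by (intro mult_left_mono) auto
  also have "\<dots> = 1" unfolding exp_add[symmetric] by (simp add: algebra_simps)
  finally show ?thesis using True k by (simp add: Zk_def powr_def)
qed (auto simp: Zk_def)

lemma Zk_expectation_lower: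
  assumes k: "1 \<le> k" and Lk: "L * l k \<le> 1 / 4"
  defines "e \<equiv> real L ^ 3 * (card (Bk k) * (l k) ^ 3)"
  shows "exp (- 2 * e) - 2 * exp (8 * e - d\<^sup>2 * (1 - d) ^ 3 / 4 * ln k) \<le> U.expectation (Zk k)"
proof -
  let ?b = "real (card (Bk k))"
  let ?C = "{x. d / 2 * (l k * ?b / 2) < \<bar>unweighted (Bk k) x - l k * ?b / 2\<bar>}"
  have Cint: "integrable unit_interval_space (\<lambda>x. tilt (l k) (Bk k) x * indicator ?C x)"
  proof -
    have "integrable unit_interval_space (\<lambda>x. tilt (l k) (Bk k) x - Zk k x)"
      by (intro Bochner_Integration.integrable_diff tilt_integrable Zk_integrable)
    then show ?thesis
      by (rule Bochner_Integration.integrable_cong[THEN iffD1, rotated 2])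
         (auto simp: indicator_def Zk_def Gk_def)
  qed
  have "U.expectation (Zk k) = U.expectation (\<lambda>x. tilt (l k) (Bk k) x - tilt (l k) (Bk k) x * indicator ?C x)"
    by (rule Bochner_Integration.integral_cong) (auto simp: indicator_def Zk_def Gk_def)
  also have "\<dots> = U.expectation (tilt (l k) (Bk k)) - U.expectation (\<lambda>x. tilt (l k) (Bk k) x * indicator ?C x)"
    by (rule Bochner_Integration.integral_diff[OF tilt_integrable Cint])
  finally have eq: "U.expectation (Zk k) = \<dots>" .
  have "U.expectation (\<lambda>x. tilt (l k) (Bk k) x * indicator ?C x) \<le> 2 * exp (8 * e - (d / 2)\<^sup>2 * (l k)\<^sup>2 * ?b / 4)"
    unfolding e_def by (rule tilt_concentration[OF separated_Bk l_nonneg Lk]) (use d in auto)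
  also have "\<dots> \<le> 2 * exp (8 * e - d\<^sup>2 * (1 - d) ^ 3 / 4 * ln k)"
  proof -
    have "4 * (1 - d) ^ 3 * ln k = (1 - d) * ((l k)\<^sup>2 * \<theta> ^ k)"
      unfolding l_sq[OF k] by (simp add: eval_nat_numeral)
    also have "\<dots> = (l k)\<^sup>2 * ((1 - d) * \<theta> ^ k)" by simp
    also have "\<dots> \<le> (l k)\<^sup>2 * ?b" using card_Bk(2)[OF k] by (intro mult_left_mono) auto
    finally have "d\<^sup>2 / 16 * (4 * (1 - d) ^ 3 * ln k) \<le> d\<^sup>2 / 16 * ((l k)\<^sup>2 * ?b)"
      by (intro mult_left_mono) auto
    then show ?thesis by (simp add: power_divide algebra_simps)
  qed
  finally have "U.expectation (\<lambda>x. tilt (l k) (Bk k) x * indicator ?C x) \<le> 2 * exp (8 * e - d\<^sup>2 * (1 - d) ^ 3 / 4 * ln k)" .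
  moreover have "exp (- 2 * e) \<le> U.expectation (tilt (l k) (Bk k))"
    using tilt_expectation(2)[OF separated_Bk, of "l k" k] l_nonneg[of k] Lk by (simp add: e_def)
  ultimately show ?thesis unfolding eq by linarith
qed

lemma frequently_Bk_large:
  "AE x in unit_interval_space. \<forall>m. \<exists>k\<ge>m. (1 - d) ^ 3 * v k \<le> unweighted (Bk k) x"
proof -
  let ?a = "\<lambda>s k. if sh k = s then real k powr - (1 - d) else 0"
  obtain s where s: "\<not> summable (?a s)"
  proof (rule ccontr)
    assume "\<not> thesis"
    then have "summable (\<lambda>k. \<Sum>s<L + g. ?a s k)" using that by (intro summable_sum) blast
    moreover have "(\<Sum>s<L + g. ?a s k) = real k powr - (1 - d)" for k
      using sh(1)[of k] by simp
    ultimately show False using d by (simp add: summable_real_powr_iff)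
  qed
  have E0: "(\<lambda>k. real L ^ 3 * (8 * ln (real k) * sqrt (ln (real k) / 2 ^ k))) \<longlonglongrightarrow> real L ^ 3 * 0"
    by (intro tendsto_mult[OF tendsto_const]) real_asymp
  define e where "e k = real L ^ 3 * (8 * ln (real k) * sqrt (ln (real k) / 2 ^ k))" for k
  have e: "e \<longlonglongrightarrow> 0" using E0 by (simp add: e_def[abs_def])
  have ek: "real L ^ 3 * (card (Bk k) * (l k) ^ 3) \<le> e k" for k using error_le by (simp add: e_def)
  have l0: "(\<lambda>k. L * (2 * sqrt (ln (real k) / 2 ^ k))) \<longlonglongrightarrow> real L * 0"
    by (intro tendsto_mult[OF tendsto_const]) real_asymp
  have low: "(\<lambda>k. exp (- 2 * e k) - 2 * exp (8 * e k - d\<^sup>2 * (1 - d) ^ 3 / 4 * ln (real k))) \<longlonglongrightarrow> exp (- 2 * 0) - 2 * 0"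
  proof (intro tendsto_intros e)
    have "d\<^sup>2 * (1 - d) ^ 3 / 4 > 0" using d by simp
    then have "filterlim (\<lambda>k. d\<^sup>2 * (1 - d) ^ 3 / 4 * ln (real k)) at_top sequentially"
      by (intro filterlim_tendsto_pos_mult_at_top[OF tendsto_const]
          filterlim_compose[OF ln_at_top filterlim_real_sequentially])
    then have "filterlim (\<lambda>k. - (8 * e k) + d\<^sup>2 * (1 - d) ^ 3 / 4 * ln (real k)) at_top sequentially"
      by (intro filterlim_tendsto_add_at_top[of _ "- (8 * 0)"] tendsto_intros e)
    then have "filterlim (\<lambda>k. 8 * e k - d\<^sup>2 * (1 - d) ^ 3 / 4 * ln (real k)) at_bot sequentially"
      by (subst filterlim_uminus_at_bot) (simp only: minus_diff_eq uminus_add_conv_diff)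
    then show "(\<lambda>k. exp (8 * e k - d\<^sup>2 * (1 - d) ^ 3 / 4 * ln (real k))) \<longlonglongrightarrow> 0"
      by (rule filterlim_compose[OF exp_at_bot])
  qed
  have "AE x in unit_interval_space. \<forall>m. \<exists>k\<ge>m. x \<in> (if sh k = s then Gk k else {})"
  proof (rule quasi_independent_io[where Z = "\<lambda>k x. if sh k = s then Zk k x else 0" and a = "?a s"])
    fix \<iota> :: real assume i: "\<iota> > 0"
    have "\<forall>\<^sub>F k in sequentially. L * (2 * sqrt (ln (real k) / 2 ^ k)) < 1 / 4"
      using l0 by (rule order_tendstoD) simp
    moreover have "\<forall>\<^sub>F k in sequentially. e k < ln (1 + \<iota>) / 2"
      using e by (rule order_tendstoD) (use i in simp)
    moreover have "\<forall>\<^sub>F k in sequentially. 1 - \<iota> < exp (- 2 * e k) - 2 * exp (8 * e k - d\<^sup>2 * (1 - d) ^ 3 / 4 * ln (real k))"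
      using low by (rule order_tendstoD) (use i in simp)
    ultimately have "\<forall>\<^sub>F k in sequentially. L * (2 * sqrt (ln (real k) / 2 ^ k)) < 1 / 4 \<and> e k < ln (1 + \<iota>) / 2 \<and>
      1 - \<iota> < exp (- 2 * e k) - 2 * exp (8 * e k - d\<^sup>2 * (1 - d) ^ 3 / 4 * ln (real k)) \<and> k \<ge> 1"
      using eventually_ge_at_top[of 1] by eventually_elim simp
    then obtain m where m: "\<forall>k\<ge>m. L * (2 * sqrt (ln (real k) / 2 ^ k)) < 1 / 4 \<and> e k < ln (1 + \<iota>) / 2 \<and>
      1 - \<iota> < exp (- 2 * e k) - 2 * exp (8 * e k - d\<^sup>2 * (1 - d) ^ 3 / 4 * ln (real k)) \<and> k \<ge> 1"
      unfolding eventually_sequentially by (elim exE)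
    have Ll: "L * l k \<le> 1 / 4" if "k \<ge> m" for k
      using m that mult_left_mono[OF l_le[of k], of "real L"] by fastforce
    have exp_i: "exp (e j + e k) \<le> 1 + \<iota>" if "j \<ge> m" "k \<ge> m" for j k
    proof -
      have "e j + e k \<le> ln (1 + \<iota>)" using m[rule_format, OF that(1)] m[rule_format, OF that(2)] by linarith
      then show ?thesis using i by (simp add: ln_ge_iff)
    qed
    have e_pos: "0 \<le> e k" for k by (cases "k = 0") (auto simp: e_def)
    show "\<exists>m. \<forall>k\<ge>m. ?a s k > 0 \<longrightarrow>
      1 - \<iota> \<le> U.expectation (\<lambda>x. if sh k = s then Zk k x else 0) \<and> U.expectation (\<lambda>x. if sh k = s then Zk k x else 0) \<le> 1 + \<iota> \<and>
      (\<forall>j\<ge>m. ?a s j > 0 \<longrightarrow> j \<noteq> k \<longrightarrow>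
         U.expectation (\<lambda>x. (if sh j = s then Zk j x else 0) * (if sh k = s then Zk k x else 0)) \<le> 1 + \<iota>)"
    proof (intro exI[of _ m] allI impI conjI)
      fix k assume k: "k \<ge> m" "?a s k > 0"
      then have sk: "sh k = s" by (simp split: if_splits)
      have "1 - \<iota> \<le> exp (- 2 * e k) - 2 * exp (8 * e k - d\<^sup>2 * (1 - d) ^ 3 / 4 * ln (real k))"
        using m k by (simp add: less_imp_le)
      also have "\<dots> \<le> exp (- 2 * (real L ^ 3 * (card (Bk k) * (l k) ^ 3))) -
          2 * exp (8 * (real L ^ 3 * (card (Bk k) * (l k) ^ 3)) - d\<^sup>2 * (1 - d) ^ 3 / 4 * ln (real k))"
        using ek[of k] by (intro diff_mono mult_left_mono) auto
      also have "\<dots> \<le> U.expectation (Zk k)"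
        by (rule Zk_expectation_lower[OF _ Ll[OF k(1)]]) (use m k in simp)
      finally show "1 - \<iota> \<le> U.expectation (\<lambda>x. if sh k = s then Zk k x else 0)" using sk by simp
      have "U.expectation (Zk k) \<le> U.expectation (tilt (l k) (Bk k))"
        by (intro integral_mono Zk_integrable tilt_integrable Zk_le_tilt)
      also have "\<dots> \<le> exp (real L ^ 3 * (card (Bk k) * \<bar>l k\<bar> ^ 3))"
        by (rule tilt_expectation(1)[OF separated_Bk]) (use Ll[OF k(1)] l_nonneg[of k] in simp)
      also have "\<dots> \<le> exp (e k + e k)" using ek[of k] e_pos[of k] l_nonneg[of k] by simp
      also have "\<dots> \<le> 1 + \<iota>" by (rule exp_i[OF k(1) k(1)])
      finally show "U.expectation (\<lambda>x. if sh k = s then Zk k x else 0) \<le> 1 + \<iota>" using sk by simp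
      fix j assume j: "j \<ge> m" "?a s j > 0" "j \<noteq> k"
      then have sj: "sh j = s" by (simp split: if_splits)
      have "U.expectation (\<lambda>x. Zk j x * Zk k x) \<le> U.expectation (\<lambda>x. tilt (l j) (Bk j) x * tilt (l k) (Bk k) x)"
        by (intro integral_mono Zk_pair_integrable tilt_pair_integrable mult_mono Zk_le_tilt Zk_nonneg)
           (simp add: tilt_def)
      also have "\<dots> \<le> exp (real L ^ 3 * (card (Bk j) * \<bar>l j\<bar> ^ 3) + real L ^ 3 * (card (Bk k) * \<bar>l k\<bar> ^ 3))"
        by (rule tilt_pair_expectation[OF separated_pair Bk_disjoint])
           (use sj sk j k Ll[OF k(1)] Ll[OF j(1)] l_nonneg[of k] l_nonneg[of j] in simp_all)
      also have "\<dots> \<le> exp (e j + e k)" using ek[of k] ek[of j] l_nonneg[of k] l_nonneg[of j] by simp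
      also have "\<dots> \<le> 1 + \<iota>" by (rule exp_i[OF j(1) k(1)])
      finally show "U.expectation (\<lambda>x. (if sh j = s then Zk j x else 0) * (if sh k = s then Zk k x else 0)) \<le> 1 + \<iota>"
        using sj sk by simp
    qed
  next
    fix j k
    show "integrable unit_interval_space (\<lambda>x. if sh k = s then Zk k x else 0)"
      by (cases "sh k = s") (simp_all add: Zk_integrable)
    show "integrable unit_interval_space (\<lambda>x. (if sh j = s then Zk j x else 0) * (if sh k = s then Zk k x else 0))"
      by (cases "sh k = s"; cases "sh j = s") (simp_all add: Zk_pair_integrable)
  qed (use s Zk_bound in \<open>auto simp: Gk_event Zk_nonneg Zk_outside\<close>)
  then show ?thesis
  proof eventually_elim
    case (elim x)
    show ?case
    proof
      fix m
      obtain k where k: "k \<ge> max m 1" "x \<in> Gk k" using elim[rule_format, of "max m 1"] by (auto split: if_splits)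
      let ?b = "real (card (Bk k))"
      have lnk: "ln (real k) \<ge> 0" using k by simp
      have "(1 - d) ^ 3 * v k = (1 - d) * (l k * ((1 - d) * \<theta> ^ k) / 2)"
      proof -
        have "sqrt (ln k / \<theta> ^ k) * \<theta> ^ k = v k"
          using theta_pos lnk by (simp add: v_def real_sqrt_divide real_sqrt_mult field_simps)
        then show ?thesis by (simp add: l_def eval_nat_numeral)
      qed
      also have "\<dots> \<le> (1 - d / 2) * (l k * ?b / 2)"
        using card_Bk(2)[of k] k d l_nonneg[of k] by (intro mult_mono divide_right_mono mult_left_mono) auto
      also have "\<dots> \<le> unweighted (Bk k) x"
      proof -
        have "\<bar>unweighted (Bk k) x - l k * ?b / 2\<bar> \<le> d / 2 * (l k * ?b / 2)"
          using k(2) by (simp only: Gk_def mem_Collect_eq)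
        from abs_le_D2[OF this] show ?thesis by (simp add: algebra_simps)
      qed
      finally show "\<exists>k\<ge>m. (1 - d) ^ 3 * v k \<le> unweighted (Bk k) x" using k(1) by auto
    qed
  qed
qed


lemma frequently_S_large:
  "AE x in unit_interval_space. \<forall>m. \<exists>N\<ge>m. (1 - 7 * d) * sqrt (real N * ln (ln (real N))) \<le> S N x"
proof -
  have C: "(\<lambda>k. (ln (real k) + ln (ln \<theta>)) / ln (real k)) \<longlonglongrightarrow> 1" by real_asymp
  have "\<forall>\<^sub>F k in sequentially. (ln (real k) + ln (ln \<theta>)) / ln (real k) < 1 / (1 - d)\<^sup>2"
    by (rule order_tendstoD(2)[OF C]) (use d in \<open>simp add: power_less_one_iff abs_square_less_1\<close>)
  then have ev: "\<forall>\<^sub>F k in sequentially. (1 - d)\<^sup>2 * ln (ln (real \<theta> ^ k)) \<le> ln (real k)"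
    using eventually_ge_at_top[of 3]
  proof eventually_elim
    case (elim k)
    have "ln \<theta> > 0" using theta by simp
    then have "ln (ln (real \<theta> ^ k)) = ln (real k) + ln (ln \<theta>)"
      using elim theta by (simp add: ln_realpow ln_mult)
    moreover have "(1 - d)\<^sup>2 > 0" "ln (real k) > 0" using elim d by auto
    ultimately show ?case using elim(1) by (simp add: field_simps)
  qed
  from frequently_Bk_large eventually_Rk_small lil_upper[of 1, OF zero_less_one]
  show ?thesis
  proof eventually_elim
    case (elim x)
    from elim(2) ev have "\<forall>\<^sub>F k in sequentially. \<bar>unweighted (Rk k) x\<bar> \<le> d * v k \<and> (1 - d)\<^sup>2 * ln (ln (real \<theta> ^ k)) \<le> ln (real k)"
      by (rule eventually_conj)
    then obtain k0 where k0: "\<forall>k\<ge>k0. \<bar>unweighted (Rk k) x\<bar> \<le> d * v k \<and> (1 - d)\<^sup>2 * ln (ln (real \<theta> ^ k)) \<le> ln (real k)"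
      unfolding eventually_sequentially by (elim exE)
    from elim(3) obtain N0 where N0: "\<forall>N\<ge>N0. \<bar>S N x\<bar> \<le> (1 + 1) * sqrt (real N * ln (ln (real N)))"
      unfolding eventually_sequentially by (elim exE)
    show ?case
    proof
      fix m
      obtain k where k: "k \<ge> max (max m k0) (max 3 (Suc N0))" "(1 - d) ^ 3 * v k \<le> unweighted (Bk k) x"
        using elim(1) by blast
      define M where "M = real \<theta> ^ k"
      define w where "w = sqrt (M * ln (ln M))"
      have th: "\<theta> ^ i > i" for i
        using theta(1) power_gt_expt[of \<theta> i] by simp
      have lnM: "ln (ln M) > 0"
      proof -
        have "exp 1 < (2::real) ^ 3" using exp_le by simp
        also have "(2::real) ^ 3 \<le> real \<theta> ^ 3" using theta by (intro power_mono) auto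
        also have "real \<theta> ^ 3 \<le> M" unfolding M_def using k theta by (intro power_increasing) auto
        finally have "exp 1 < M" .
        then have "ln M > 1" by (metis exp_gt_zero less_trans ln_exp ln_less_cancel_iff)
        then show ?thesis by simp
      qed
      have Mpos: "M > 0" using theta by (simp add: M_def)
      have wpos: "w \<ge> 0" using Mpos lnM by (simp add: w_def)
      have vw: "(1 - d) * w \<le> v k"
      proof -
        have "(1 - d) * w = sqrt (M * ((1 - d)\<^sup>2 * ln (ln M)))"
          using d by (simp add: w_def real_sqrt_mult)
        also have "\<dots> \<le> v k"
          unfolding v_def M_def[symmetric] using k0[rule_format, of k] k Mpos
          by (intro real_sqrt_le_mono mult_left_mono) (auto simp: M_def)
        finally show ?thesis .
      qed
      have vpos: "v k \<ge> 0" using k theta by (simp add: v_def)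
      have prev: "\<bar>S (\<theta> ^ (k - 1)) x\<bar> \<le> d * w"
      proof -
        let ?N = "\<theta> ^ (k - 1)"
        have "N0 \<le> ?N" using th[of "k - 1"] k by linarith
        then have "\<bar>S ?N x\<bar> \<le> 2 * sqrt (real ?N * ln (ln (real ?N)))"
          using N0[rule_format, of ?N] by (simp only: one_add_one)
        also have "\<dots> \<le> 2 * sqrt (M / \<theta> * ln (ln M))"
        proof (intro mult_left_mono real_sqrt_le_mono mult_mono)
          show NM: "real ?N \<le> M / \<theta>" using theta k by (cases k) (auto simp: M_def)
          have "k - 1 < ?N" by (rule th)
          then have N1: "2 < ?N" using k by linarith
          have "real ?N \<le> M" using NM theta Mpos by (intro order_trans[OF NM]) (simp add: field_simps)
          moreover have "real 3 \<le> real ?N" by (subst of_nat_le_iff) (use N1 in linarith)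
          then have three: "3 \<le> real ?N" by (simp only: of_nat_numeral)
          ultimately have "ln (real ?N) \<le> ln M" by (intro ln_mono) linarith+
          moreover have one: "1 \<le> ln (real ?N)" using three exp_le by (subst ln_ge_iff) linarith+
          ultimately show "ln (ln (real ?N)) \<le> ln (ln M)" by (intro ln_mono[of "ln (real ?N)"]) linarith+
          show "0 \<le> ln (ln (real ?N))" using one by (rule ln_ge_zero)
        qed (use theta Mpos lnM in auto)
        also have "\<dots> = sqrt (4 / \<theta>) * w"
          by (simp add: w_def real_sqrt_mult real_sqrt_divide)
        also have "\<dots> \<le> d * w"
        proof (rule mult_right_mono[OF _ wpos])
          have "4 / real \<theta> \<le> d\<^sup>2" using theta d by (simp add: field_simps)
          then show "sqrt (4 / \<theta>) \<le> d" using d by (intro real_le_lsqrt) auto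
        qed
        finally show ?thesis .
      qed
      have split: "S (\<theta> ^ k) x - S (\<theta> ^ (k - 1)) x = unweighted (Bk k) x + unweighted (Rk k) x"
      proof -
        have "S (\<theta> ^ k) x - S (\<theta> ^ (k - 1)) x = unweighted (Ak k) x"
          unfolding Ak_def using theta by (intro S_diff power_increasing) auto
        also have "\<dots> = unweighted (Bk k \<union> Rk k) x" by (rule arg_cong[where f = "\<lambda>A. unweighted A x"]) (auto simp: Bk_def Rk_def)
        also have "\<dots> = unweighted (Bk k) x + unweighted (Rk k) x"
          unfolding unweighted_def block_sum_def by (rule sum.union_disjoint) (auto simp: Bk_def Rk_def Ak)
        finally show ?thesis .
      qed
      have R: "\<bar>unweighted (Rk k) x\<bar> \<le> d * v k" using k0 k by simp
      have "(1 - 7 * d) * w \<le> (1 - 4 * d) * ((1 - d) * w) - d * w"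
      proof -
        have "0 \<le> d * w + 4 * d * d * w" using d wpos by simp
        then show ?thesis by (simp add: algebra_simps)
      qed
      also have "\<dots> \<le> (1 - 4 * d) * v k - d * w"
        using vw d by (intro diff_mono mult_left_mono) auto
      also have "\<dots> \<le> (1 - d) ^ 3 * v k - d * v k - d * w"
      proof -
        have "1 + real 3 * (- d) \<le> (1 + - d) ^ 3" using d by (intro Bernoulli_inequality) simp
        then have "(1 - 3 * d) * v k \<le> (1 - d) ^ 3 * v k" using vpos by (intro mult_right_mono) auto
        then show ?thesis by (simp add: algebra_simps)
      qed
      also have "\<dots> \<le> S (\<theta> ^ k) x" using k(2) R prev split by linarith
      finally have "(1 - 7 * d) * sqrt (real (\<theta> ^ k) * ln (ln (real (\<theta> ^ k)))) \<le> S (\<theta> ^ k) x"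
        by (simp add: w_def M_def)
      moreover have "m \<le> \<theta> ^ k" using th[of k] k by linarith
      ultimately show "\<exists>N\<ge>m. (1 - 7 * d) * sqrt (real N * ln (ln (real N))) \<le> S N x" by blast
    qed
  qed
qed

end

context permuted_lacunary
begin

lemma lil_lower:
  fixes \<delta> :: real
  assumes "0 < \<delta>" "\<delta> \<le> 1"
  shows "AE x in unit_interval_space. \<forall>m. \<exists>N\<ge>m. (1 - \<delta>) * sqrt (real N * ln (ln (real N))) \<le> S N x"
proof -
  define d where "d = \<delta> / 7"
  have d: "0 < d" "d \<le> 1 / 7" using assms by (auto simp: d_def)
  obtain g where g: "K \<le> q ^ g" using exists_gap by blast
  define \<theta> where "\<theta> = max 2 (nat \<lceil>4 / d\<^sup>2\<rceil>)"
  have "real (nat \<lceil>4 / d\<^sup>2\<rceil>) \<le> \<theta>" by (simp add: \<theta>_def)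
  then have theta: "2 \<le> \<theta>" "4 / d\<^sup>2 \<le> \<theta>"
    using real_nat_ceiling_ge[of "4 / d\<^sup>2"] by (simp add: \<theta>_def, linarith)
  define L where "L = Suc (nat \<lceil>real g / (d\<^sup>2 / 4)\<rceil>)"
  have "real g / (d\<^sup>2 / 4) \<le> L" unfolding L_def using real_nat_ceiling_ge[of "real g / (d\<^sup>2 / 4)"] by linarith
  then have "g / (L + g) \<le> d\<^sup>2 / 4"
  proof -
    assume a: "real g / (d\<^sup>2 / 4) \<le> L"
    have "d\<^sup>2 / 4 > 0" using d by simp
    then have "real g \<le> d\<^sup>2 / 4 * L" using a by (simp only: pos_divide_le_eq mult.commute)
    also have "\<dots> \<le> d\<^sup>2 / 4 * (L + g)" by (intro mult_left_mono) auto
    moreover have "0 < real (L + g)" by (simp only: of_nat_0_less_iff L_def)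
    ultimately show ?thesis by (simp only: pos_divide_le_eq)
  qed
  have "\<forall>k. \<exists>s<L + g. (L + g) * card {i \<in> \<sigma> ` {\<theta> ^ (k - 1)<..\<theta> ^ k}. \<not> (i + s) mod (L + g) < L}
         \<le> g * card (\<sigma> ` {\<theta> ^ (k - 1)<..\<theta> ^ k})"
    by (intro allI exists_good_shift) (auto simp: L_def)
  from choice[OF this] obtain sh where sh: "\<forall>k. sh k < L + g \<and> (L + g) * card {i \<in> \<sigma> ` {\<theta> ^ (k - 1)<..\<theta> ^ k}. \<not> (i + sh k) mod (L + g) < L}
         \<le> g * card (\<sigma> ` {\<theta> ^ (k - 1)<..\<theta> ^ k})" by (elim exE)
  interpret tilted_blocks n q \<sigma> d \<theta> g L sh
    by unfold_locales (fact d theta g sh[rule_format, THEN conjunct1] sh[rule_format, THEN conjunct2] \<open>g / (L + g) \<le> d\<^sup>2 / 4\<close> | simp add: L_def)+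
  show ?thesis using frequently_S_large by (simp add: d_def)
qed

text \<open>Small \<open>N\<close> with \<open>ln (ln N) \<le> 0\<close> produce junk quotients, which the limit superior ignores.\<close>
lemma limsup_S:
  "AE x in unit_interval_space. limsup (\<lambda>N. ereal (S N x / sqrt (real N * ln (ln (real N))))) = 1"
proof -
  have "AE x in unit_interval_space. \<forall>j. \<forall>\<^sub>F N in sequentially. \<bar>S N x\<bar> \<le> (1 + 1 / real (Suc j)) * sqrt (real N * ln (ln (real N)))"
    by (rule AE_all_countable[THEN iffD2]) (intro allI lil_upper; simp)
  moreover have "AE x in unit_interval_space. \<forall>j m. \<exists>N\<ge>m. (1 - 1 / real (Suc j)) * sqrt (real N * ln (ln (real N))) \<le> S N x"
    by (rule AE_all_countable[THEN iffD2]) (intro allI lil_lower; simp)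
  ultimately show ?thesis
  proof eventually_elim
    case (elim x)
    let ?w = "\<lambda>N. sqrt (real N * ln (ln (real N)))"
    let ?f = "\<lambda>N. ereal (S N x / ?w N)"
    have wpos: "\<forall>\<^sub>F N in sequentially. ?w N > 0" by real_asymp
    have up: "limsup ?f \<le> ereal (1 + 1 / real (Suc j))" for j
    proof (rule Limsup_bounded)
      from elim(1)[rule_format, of j] wpos
      show "\<forall>\<^sub>F N in sequentially. ?f N \<le> ereal (1 + 1 / real (Suc j))"
      proof eventually_elim
        case (elim N)
        have "S N x \<le> (1 + 1 / real (Suc j)) * ?w N" using elim(1) by linarith
        then show ?case unfolding ereal_less_eq(3) by (subst pos_divide_le_eq[OF elim(2)])
      qed
    qed
    have low: "ereal (1 - 1 / real (Suc j)) \<le> limsup ?f" for j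
      unfolding limsup_INF_SUP
    proof (rule INF_greatest)
      fix m
      obtain N0 where N0: "\<forall>N\<ge>N0. ?w N > 0" using wpos unfolding eventually_sequentially by (elim exE)
      obtain N where N: "N \<ge> max m N0" "(1 - 1 / real (Suc j)) * ?w N \<le> S N x" using elim(2) by blast
      then have "?w N > 0" using N0 by simp
      then have "1 - 1 / real (Suc j) \<le> S N x / ?w N" using N(2) by (subst pos_le_divide_eq)
      then have "ereal (1 - 1 / real (Suc j)) \<le> ?f N" by simp
      then show "ereal (1 - 1 / real (Suc j)) \<le> (SUP N\<in>{m..}. ?f N)"
        by (rule SUP_upper2[rotated]) (use N(1) in simp)
    qed
    have l0: "(\<lambda>j. 1 / real (Suc j)) \<longlonglongrightarrow> 0" by real_asymp
    have "(\<lambda>j. ereal (1 + 1 / real (Suc j))) \<longlonglongrightarrow> ereal (1 + 0)"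
      by (intro tendsto_ereal tendsto_add tendsto_const l0)
    then have "limsup ?f \<le> ereal (1 + 0)" by (rule LIMSEQ_le_const) (use up in blast)
    moreover have "(\<lambda>j. ereal (1 - 1 / real (Suc j))) \<longlonglongrightarrow> ereal (1 - 0)"
      by (intro tendsto_ereal tendsto_diff tendsto_const l0)
    then have "ereal (1 - 0) \<le> limsup ?f" by (rule LIMSEQ_le_const2) (use low in blast)
    ultimately show ?case by (simp add: antisym one_ereal_def)
  qed
qed

end

section \<open>The central limit theorem\<close>

lemma norm_cis_diff_le: "norm (cis a - cis b) \<le> \<bar>a - b\<bar>"
proof -
  have "cis a - cis b = cis b * (cis (a - b) - 1)" by (simp add: algebra_simps cis_mult)
  then have "norm (cis a - cis b) = norm (cis (a - b) - 1)" by (simp add: norm_mult)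
  also have "\<dots> \<le> \<bar>a - b\<bar>" using iexp_approx1[of "a - b" 0] by (simp add: cis_conv_exp)
  finally show ?thesis .
qed

lemma exp_minus_lipschitz:
  fixes y z :: real
  assumes "0 \<le> y" "y \<le> z"
  shows "\<bar>exp (- y) - exp (- z)\<bar> \<le> z - y"
proof -
  have "1 - (z - y) \<le> exp (- (z - y))" using exp_ge_add_one_self[of "- (z - y)"] by linarith
  then have "exp (- y) * (1 - (z - y)) \<le> exp (- y) * exp (- (z - y))"
    by (rule mult_left_mono) simp
  also have "\<dots> = exp (- z)" by (simp flip: exp_add)
  finally have "exp (- y) - exp (- z) \<le> exp (- y) * (z - y)" by (simp add: algebra_simps)
  also have "\<dots> \<le> 1 * (z - y)" using assms by (intro mult_right_mono) auto
  finally show ?thesis using assms by simp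
qed

lemma real_distribution_normal_var:
  assumes "v > 0"
  shows "real_distribution (normal_distribution_var \<mu> v)"
proof -
  interpret prob_space "normal_distribution_var \<mu> v"
    unfolding normal_distribution_var_def using assms by (intro prob_space_normal_density) simp
  show ?thesis by unfold_locales (simp_all add: normal_distribution_var_def)
qed

lemma char_normal_var:
  assumes v: "v > 0"
  shows "char (normal_distribution_var 0 v) t = complex_of_real (exp (- (v * t\<^sup>2 / 2)))"
proof -
  interpret N: real_distribution std_normal_distribution by (rule real_dist_normal_dist)
  have "distributed std_normal_distribution lborel (\<lambda>x. x) std_normal_density"
    by (simp add: distributed_def distr_id2)
  from N.normal_density_affine[OF this _ , of "sqrt v" 0]
  have "distr std_normal_distribution lborel (\<lambda>x. sqrt v * x) = density lborel (normal_density 0 (sqrt v))"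
    using v by (simp add: distributed_def)
  then have "normal_distribution_var 0 v = distr std_normal_distribution lborel (\<lambda>x. sqrt v * x)"
    by (simp add: normal_distribution_var_def)
  then have "char (normal_distribution_var 0 v) t = (CLINT x|std_normal_distribution. iexp (t * (sqrt v * x)))"
    unfolding char_def by (subst integral_distr[symmetric, of "\<lambda>x. sqrt v * x" _ lborel]) auto
  also have "\<dots> = char std_normal_distribution (t * sqrt v)"
    unfolding char_def by (simp add: mult.assoc)
  also have "\<dots> = complex_of_real (exp (- (v * t\<^sup>2 / 2)))"
    using v by (simp add: char_std_normal_distribution power_mult_distrib mult.commute)
  finally show ?thesis .
qed

context permuted_lacunary
begin

lemma char_S_bound:
  fixes \<eta> t :: real and N L g :: nat
  assumes N: "0 < N" and g: "K \<le> q ^ g" and L: "0 < L" "g / (L + g) \<le> \<eta>\<^sup>2"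
    and eta: "0 < \<eta>" "\<eta> \<le> 1" and c: "L * (\<bar>t\<bar> / sqrt N) \<le> 1 / 2"
  defines "e \<equiv> real L ^ 3 * (\<bar>t\<bar> ^ 3 / sqrt N)"
  shows "norm ((LINT x|unit_interval_space. cis (t / sqrt N * S N x)) - complex_of_real (exp (- (t\<^sup>2 / 4))))
    \<le> \<eta> * (t\<^sup>2 + 1) + (exp e - 1 + e)"
proof -
  define A where "A = \<sigma> ` {0<..N}"
  have A: "finite A" "A \<subseteq> {1..}" "card A = N"
    unfolding A_def by (simp_all add: sigma_image card_sigma_image del: One_nat_def)
  obtain s where s: "(L + g) * card {k \<in> A. \<not> (k + s) mod (L + g) < L} \<le> g * card A"
    using exists_good_shift[OF A(1), of L g] L by auto
  define B where "B = {k \<in> A. (k + s) mod (L + g) < L}"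
  define R where "R = {k \<in> A. \<not> (k + s) mod (L + g) < L}"
  have BR: "A = B \<union> R" "B \<inter> R = {}" "finite B" "finite R" "R \<subseteq> {1..}" using A by (auto simp: B_def R_def)
  have sep: "separated L B" unfolding B_def by (rule separated_shift[OF A(1,2) g L(1)])
  have cR: "card R \<le> \<eta>\<^sup>2 * N"
  proof -
    have "real (L + g) * card R \<le> g * N"
      using s A(3) unfolding R_def by (simp only: of_nat_mult[symmetric] of_nat_le_iff)
    then have "card R \<le> g / (L + g) * N" using L by (simp add: field_simps)
    also have "\<dots> \<le> \<eta>\<^sup>2 * N" using L by (intro mult_right_mono) auto
    finally show ?thesis .
  qed
  have cBR: "real (card B) + card R = N"
    using card_Un_disjoint[OF BR(3,4,2)] A(3) BR(1) by simp
  define u where "u = t / sqrt N"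
  have usq: "u\<^sup>2 * N = t\<^sup>2" using N by (simp add: u_def power_divide)
  have SN: "S N x = unweighted B x + unweighted R x" for x
  proof -
    have "S N x = unweighted A x" using S_diff[of 0 N x] by (simp add: S_def A_def)
    also have "\<dots> = unweighted B x + unweighted R x"
      unfolding BR(1) unweighted_def block_sum_def using BR(3,4,2) by (rule sum.union_disjoint)
    finally show ?thesis .
  qed
  have intS: "integrable unit_interval_space (\<lambda>x. cis (u * S N x))"
    and intB: "integrable unit_interval_space (\<lambda>x. cis (u * unweighted B x))"
    and intR: "integrable unit_interval_space (\<lambda>x. (u\<^sup>2 / \<eta> * (unweighted R x)\<^sup>2 + \<eta>) / 2)"
    using eta by (intro unit_interval_integrable continuous_intros; simp)+
  have 1: "norm (U.expectation (\<lambda>x. cis (u * S N x)) - U.expectation (\<lambda>x. cis (u * unweighted B x))) \<le> \<eta> * (t\<^sup>2 + 2) / 4"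
  proof -
    have "norm (U.expectation (\<lambda>x. cis (u * S N x)) - U.expectation (\<lambda>x. cis (u * unweighted B x))) =
      norm (U.expectation (\<lambda>x. cis (u * S N x) - cis (u * unweighted B x)))"
      using intS intB by simp
    also have "\<dots> \<le> U.expectation (\<lambda>x. norm (cis (u * S N x) - cis (u * unweighted B x)))"
      by (rule integral_norm_bound)
    also have "\<dots> \<le> U.expectation (\<lambda>x. (u\<^sup>2 / \<eta> * (unweighted R x)\<^sup>2 + \<eta>) / 2)"
    proof (rule integral_mono)
      show "integrable unit_interval_space (\<lambda>x. norm (cis (u * S N x) - cis (u * unweighted B x)))"
        using intS intB by simp
      fix x
      have "norm (cis (u * S N x) - cis (u * unweighted B x)) \<le> \<bar>u * unweighted R x\<bar>"
        using norm_cis_diff_le[of "u * S N x" "u * unweighted B x"] by (simp add: SN algebra_simps)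
      also have "\<dots> \<le> (u\<^sup>2 / \<eta> * (unweighted R x)\<^sup>2 + \<eta>) / 2"
      proof -
        have "0 \<le> (\<bar>u * unweighted R x\<bar> - \<eta>)\<^sup>2" by simp
        then have "2 * \<eta> * \<bar>u * unweighted R x\<bar> \<le> u\<^sup>2 * (unweighted R x)\<^sup>2 + \<eta>\<^sup>2"
          by (simp add: power2_diff power_mult_distrib mult_ac)
        then show ?thesis using eta by (simp add: field_simps power2_eq_square)
      qed
      finally show "norm (cis (u * S N x) - cis (u * unweighted B x)) \<le> (u\<^sup>2 / \<eta> * (unweighted R x)\<^sup>2 + \<eta>) / 2" .
    qed (rule intR)
    also have "\<dots> = (u\<^sup>2 / \<eta> * (card R / 2) + \<eta>) / 2"
    proof -
      have "integrable unit_interval_space (\<lambda>x. (unweighted R x)\<^sup>2)"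
        by (intro unit_interval_integrable continuous_intros)
      moreover have "U.expectation (\<lambda>x. (unweighted R x)\<^sup>2) = card R / 2"
        unfolding unweighted_def by (subst second_moment) (use BR in auto)
      ultimately show ?thesis using U.prob_space by simp
    qed
    also have "\<dots> \<le> (u\<^sup>2 / \<eta> * (\<eta>\<^sup>2 * N / 2) + \<eta>) / 2"
      using cR eta by (intro divide_right_mono add_right_mono mult_left_mono) auto
    also have "\<dots> = \<eta> * (t\<^sup>2 + 2) / 4"
      using eta unfolding usq[symmetric] by (simp add: field_simps power2_eq_square)
    finally show ?thesis .
  qed
  have 2: "norm (U.expectation (\<lambda>x. cis (u * unweighted B x)) - complex_of_real (exp (- (u\<^sup>2 * card B / 4)))) \<le> exp e - 1 + e"
  proof -
    define e' where "e' = real L ^ 3 * (card B * \<bar>u\<bar> ^ 3)"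
    have "norm (U.expectation (\<lambda>x. cis (u * unweighted B x)) - complex_of_real (exp (- (u\<^sup>2 * card B / 4)))) \<le> exp e' - 1 + e'"
      using char_bound[OF sep, of "\<lambda>_. u"] c by (simp add: block_sum_const u_def e'_def mult_ac)
    moreover have "e' \<le> e"
    proof -
      have "card B * \<bar>u\<bar> ^ 3 \<le> N * \<bar>u\<bar> ^ 3" using cBR by (intro mult_right_mono) auto
      also have "\<dots> = \<bar>t\<bar> ^ 3 / sqrt N"
      proof -
        have "N * \<bar>u\<bar> ^ 3 = (u\<^sup>2 * N) * \<bar>u\<bar>" by (simp add: eval_nat_numeral abs_mult_self_eq mult_ac)
        also have "\<dots> = \<bar>t\<bar> ^ 3 / sqrt N" unfolding usq by (simp add: u_def eval_nat_numeral abs_mult_self_eq)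
        finally show ?thesis .
      qed
      finally show ?thesis unfolding e'_def e_def by (intro mult_left_mono) auto
    qed
    ultimately show ?thesis by (smt (verit) exp_le_cancel_iff)
  qed
  have 3: "norm (complex_of_real (exp (- (u\<^sup>2 * card B / 4))) - complex_of_real (exp (- (t\<^sup>2 / 4)))) \<le> t\<^sup>2 * \<eta> / 4"
  proof -
    have le: "u\<^sup>2 * card B / 4 \<le> t\<^sup>2 / 4"
      unfolding usq[symmetric] using cBR by (intro divide_right_mono mult_left_mono) auto
    have "norm (complex_of_real (exp (- (u\<^sup>2 * card B / 4))) - complex_of_real (exp (- (t\<^sup>2 / 4)))) =
      \<bar>exp (- (u\<^sup>2 * card B / 4)) - exp (- (t\<^sup>2 / 4))\<bar>"
      by (simp only: of_real_diff[symmetric] norm_of_real)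
    also have "\<dots> \<le> t\<^sup>2 / 4 - u\<^sup>2 * card B / 4" by (rule exp_minus_lipschitz[OF _ le]) simp
    also have "\<dots> = u\<^sup>2 * card R / 4" unfolding usq[symmetric] cBR[symmetric] by (simp add: algebra_simps)
    also have "\<dots> \<le> u\<^sup>2 * (\<eta>\<^sup>2 * N) / 4" using cR by (intro divide_right_mono mult_left_mono) auto
    also have "\<dots> = t\<^sup>2 * \<eta>\<^sup>2 / 4" unfolding usq[symmetric] by simp
    also have "\<dots> \<le> t\<^sup>2 * \<eta> / 4"
      using eta mult_left_mono[of \<eta> 1 \<eta>] by (intro divide_right_mono mult_left_mono) (auto simp: power2_eq_square)
    finally show ?thesis .
  qed
  have "norm (U.expectation (\<lambda>x. cis (u * S N x)) - complex_of_real (exp (- (t\<^sup>2 / 4)))) \<le>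
    \<eta> * (t\<^sup>2 + 2) / 4 + (exp e - 1 + e) + t\<^sup>2 * \<eta> / 4"
    by (rule norm_diff_triangle_le[OF norm_diff_triangle_le[OF 1 2] 3])
  also have "\<dots> \<le> \<eta> * (t\<^sup>2 + 1) + (exp e - 1 + e)"
  proof -
    have "\<eta> * (t\<^sup>2 + 1) - (\<eta> * (t\<^sup>2 + 2) / 4 + t\<^sup>2 * \<eta> / 4) = \<eta> * (t\<^sup>2 + 1) / 2"
      by (simp add: field_simps)
    also have "\<dots> \<ge> 0" using eta by simp
    finally show ?thesis by simp
  qed
  finally show ?thesis by (simp add: u_def)
qed

lemma char_S_tendsto:
  fixes t :: real
  shows "(\<lambda>N. LINT x|unit_interval_space. cis (t / sqrt N * S N x)) \<longlonglongrightarrow> complex_of_real (exp (- (t\<^sup>2 / 4)))"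
proof (rule tendstoI)
  fix r :: real assume r: "r > 0"
  define \<eta> where "\<eta> = min 1 (r / (2 * (t\<^sup>2 + 1)))"
  have t1: "t\<^sup>2 + 1 > 0" by (simp add: add_nonneg_pos)
  have eta: "0 < \<eta>" "\<eta> \<le> 1" using r t1 by (auto simp: \<eta>_def)
  have "\<eta> \<le> r / (2 * (t\<^sup>2 + 1))" by (simp add: \<eta>_def)
  then have etar: "\<eta> * (t\<^sup>2 + 1) \<le> r / 2" using t1 by (simp add: field_simps)
  obtain g where g: "K \<le> q ^ g" using exists_gap by blast
  have "(\<lambda>L. real g / (real L + real g)) \<longlonglongrightarrow> 0" by real_asymp
  then have "\<forall>\<^sub>F L in sequentially. real g / (real L + real g) < \<eta>\<^sup>2"
    by (rule order_tendstoD) (use eta in simp)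
  then have "\<forall>\<^sub>F L in sequentially. real g / (real L + real g) < \<eta>\<^sup>2 \<and> 0 < L"
    using eventually_gt_at_top by (rule eventually_conj)
  then obtain L where L: "real g / (real L + real g) < \<eta>\<^sup>2" "0 < L"
    using eventually_happens'[OF sequentially_bot] by blast
  have s0: "(\<lambda>N. 1 / sqrt (real N)) \<longlonglongrightarrow> 0" by real_asymp
  have "(\<lambda>N. L * (\<bar>t\<bar> * (1 / sqrt (real N)))) \<longlonglongrightarrow> L * (\<bar>t\<bar> * 0)"
    by (intro tendsto_intros s0)
  then have ev1: "\<forall>\<^sub>F N in sequentially. L * (\<bar>t\<bar> * (1 / sqrt (real N))) < 1 / 2"
    by (rule order_tendstoD) simp
  let ?e = "\<lambda>N. real L ^ 3 * (\<bar>t\<bar> ^ 3 * (1 / sqrt (real N)))"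
  have "(\<lambda>N. exp (?e N) - 1 + ?e N) \<longlonglongrightarrow> exp (real L ^ 3 * (\<bar>t\<bar> ^ 3 * 0)) - 1 + real L ^ 3 * (\<bar>t\<bar> ^ 3 * 0)"
    by (intro tendsto_intros s0)
  then have ev2: "\<forall>\<^sub>F N in sequentially. exp (?e N) - 1 + ?e N < r / 2"
    by (rule order_tendstoD) (use r in simp)
  from ev1 ev2 eventually_gt_at_top[of 0]
  show "\<forall>\<^sub>F N in sequentially. dist (LINT x|unit_interval_space. cis (t / sqrt N * S N x)) (complex_of_real (exp (- (t\<^sup>2 / 4)))) < r"
  proof eventually_elim
    case (elim N)
    have "dist (LINT x|unit_interval_space. cis (t / sqrt N * S N x)) (complex_of_real (exp (- (t\<^sup>2 / 4))))
       \<le> \<eta> * (t\<^sup>2 + 1) + (exp (real L ^ 3 * (\<bar>t\<bar> ^ 3 / sqrt N)) - 1 + real L ^ 3 * (\<bar>t\<bar> ^ 3 / sqrt N))"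
      unfolding dist_norm
      by (rule char_S_bound[OF elim(3) g L(2) _ eta]) (use L(1) elim(1) in simp_all)
    also have "\<dots> = \<eta> * (t\<^sup>2 + 1) + (exp (?e N) - 1 + ?e N)" by simp
    also have "\<dots> < r" using elim(2) etar by linarith
    finally show ?case .
  qed
qed

lemma weak_conv_S:
  "weak_conv_m (\<lambda>N. distr unit_interval_space borel (\<lambda>x. S N x / sqrt (real N))) (normal_distribution_var 0 (1 / 2))"
proof (rule levy_continuity)
  have meas: "(\<lambda>x. S N x / sqrt (real N)) \<in> borel_measurable unit_interval_space" for N
    by (rule unit_interval_measurable) measurable
  show "real_distribution (distr unit_interval_space borel (\<lambda>x. S N x / sqrt (real N)))" for N
    by (rule U.real_distribution_distr[OF meas])
  show "real_distribution (normal_distribution_var 0 (1 / 2))" by (rule real_distribution_normal_var) simp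
  fix t
  have "char (distr unit_interval_space borel (\<lambda>x. S N x / sqrt (real N))) t =
      (LINT x|unit_interval_space. cis (t / sqrt N * S N x))" for N
    unfolding char_def by (subst integral_distr[OF meas]) (auto simp: cis_conv_exp)
  then show "(\<lambda>N. char (distr unit_interval_space borel (\<lambda>x. S N x / sqrt (real N))) t) \<longlonglongrightarrow> char (normal_distribution_var 0 (1 / 2)) t"
    using char_S_tendsto[of t] by (simp add: char_normal_var)
qed

end

theorem theorem1:
  fixes n :: "nat \<Rightarrow> nat" and q :: real and \<sigma> :: "nat \<Rightarrow> nat"
  assumes pos: "\<And>k. k \<ge> 1 \<Longrightarrow> n k > 0"
    and q: "q > 1"
    and gap: "\<And>k. k \<ge> 1 \<Longrightarrow> real (n (Suc k)) / real (n k) \<ge> q"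
    and perm: "bij_betw \<sigma> {1..} {1..}"
  defines "S \<equiv> (\<lambda>N x. \<Sum>k=1..N. cos (2 * pi * real (n (\<sigma> k)) * x))"
  shows "weak_conv_m (\<lambda>N. distr unit_interval_space borel (\<lambda>x. S N x / sqrt (real N)))
           (normal_distribution_var 0 (1/2)) \<and>
         (AE x in unit_interval_space.
           limsup (\<lambda>N. ereal (S N x / sqrt (real N * ln (ln (real N))))) = 1)"
proof -
  interpret P: permuted_lacunary n q \<sigma>
    by unfold_locales (fact pos q gap perm)+
  have "S = P.S" by (intro ext) (simp only: S_def P.S_def)
  then show ?thesis using P.weak_conv_S P.limsup_S by simp
qed

end
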